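(* Let $\hbar>0$ and let $R=R^*\in\mathcal L^1(L^2(\mathbb R^d))$ with Wigner function $W_\hbar[R](x,\xi)$. Assume that $(x,y)\mapsto\mathcal F_{\xi\to y}W_\hbar[R](x,y)$ (the partial Fourier transform of $W_\hbar[R]$ in the $\xi$-variable) is of class $C^1$ on $\mathbb R^d\times\mathbb R^d$ and that $\mathcal F_{\xi\to y}W_\hbar[R](x,y)\ne0$ for all $x,y\in\mathbb R^d$. Then $R$ is a rank-one density operator if and only if, for all $j,k=1,\ldots,d$, the following identities hold in $\mathcal D'(\mathbb R^d\times\mathbb R^d)$: \[ \tfrac4{\hbar^2}\,\partial_{y_j}\left(\frac{\partial_{y_k}\mathcal F_{\xi\to y}W_\hbar[R](x,y)}{\mathcal F_{\xi\to y}W_\hbar[R](x,y)}\right)=\partial_{x_j}\left(\frac{\partial_{x_k}\mathcal F_{\xi\to y}W_\hbar[R](x,y)}{\mathcal F_{\xi\to y}W_\hbar[R](x,y)}\right), \] \[ \partial_{y_j}\left(\frac{\partial_{x_k}\mathcal F_{\xi\to y}W_\hbar[R](x,y)}{\mathcal F_{\xi\to y}W_\hbar[R](x,y)}\right)=\partial_{x_j}\left(\frac{\partial_{y_k}\mathcal F_{\xi\to y}W_\hbar[R](x,y)}{\mathcal F_{\xi\to y}W_\hbar[R](x,y)}\right). \]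
   Context: $\mathcal L^1(L^2(\mathbb R^d))$ is the space of trace-class operators on $L^2(\mathbb R^d)$; for $R$ in this space, $R(X,Y)$ denotes its integral kernel. A density operator on $L^2(\mathbb R^d)$ is a trace-class operator $R=R^*\ge0$ with $\mathrm{tr}\,R=1$. The Wigner function (Wigner transform) of $R$ is \[ W_\hbar[R](x,\xi):=\tfrac1{(2\pi)^d}\int_{\mathbb R^d}e^{-i\xi\cdot y}\,R\left(x+\tfrac\hbar2y,\,x-\tfrac\hbar2y\right)dy, \] and the partial Fourier transform is $\mathcal F_{\xi\to y}W(x,y)=\int_{\mathbb R^d}e^{-i\xi\cdot y}W(x,\xi)\,d\xi$, so that $\mathcal F_{\xi\to y}W_\hbar[R](x,y)=R(x-\tfrac\hbar2y,\,x+\tfrac\hbar2y)$.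
   Formalization: The hypothesis tr R = 1 is added: without it the "if" direction fails, since for the projector P on a Gaussian, R = 2P or R = -P satisfies all hypotheses and identities but is not a density operator. *)

theory Defs
  imports "HOL-Analysis.Analysis"
begin

section \<open>The Hilbert space of square-integrable functions\<close>

text \<open>
  Elements of the Hilbert space are represented by Borel functions; functions that agree
  almost everywhere are the same vector, so vector equations are stated with
  \<open>ae_eq\<close>. The inner product is linear in its first argument.
\<close>

definition L2 :: "('a::euclidean_space \<Rightarrow> complex) set" where
  "L2 = {f. f \<in> borel_measurable lborel \<and> integrable lborel (\<lambda>x. (cmod (f x))\<^sup>2)}"

definition ae_eq :: "('a::euclidean_space \<Rightarrow> complex) \<Rightarrow> ('a \<Rightarrow> complex) \<Rightarrow> bool" where
  "ae_eq f g \<longleftrightarrow> (AE x in lborel. f x = g x)"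

definition L2_inner :: "('a::euclidean_space \<Rightarrow> complex) \<Rightarrow> ('a \<Rightarrow> complex) \<Rightarrow> complex" where
  "L2_inner f g = (LINT x|lborel. f x * cnj (g x))"

definition L2_norm :: "('a::euclidean_space \<Rightarrow> complex) \<Rightarrow> real" where
  "L2_norm f = sqrt (LINT x|lborel. (cmod (f x))\<^sup>2)"

text \<open>
  Orthonormal basis: an orthonormal set whose linear span is dense. Distinct members
  cannot agree almost everywhere, because their inner product would then be 1.
\<close>

definition is_onb :: "('a::euclidean_space \<Rightarrow> complex) set \<Rightarrow> bool" where
  "is_onb B \<longleftrightarrow> B \<subseteq> L2 \<and>
     (\<forall>e\<in>B. \<forall>e'\<in>B. L2_inner e e' = (if e = e' then 1 else 0)) \<and>
     (\<forall>f\<in>L2. \<forall>\<epsilon>>0. \<exists>S c. finite S \<and> S \<subseteq> B \<and> L2_norm (\<lambda>x. f x - (\<Sum>e\<in>S. c e * e x)) < \<epsilon>)"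

section \<open>Operators\<close>

type_synonym 'a operator = "('a \<Rightarrow> complex) \<Rightarrow> 'a \<Rightarrow> complex"

text \<open>
  Only the values on \<^term>\<open>L2\<close> matter. Linearity and boundedness together make the operator
  compatible with almost-everywhere equality.
\<close>

definition bounded_operator :: "'a::euclidean_space operator \<Rightarrow> bool" where
  "bounded_operator T \<longleftrightarrow>
     (\<forall>f\<in>L2. T f \<in> L2) \<and>
     (\<forall>f\<in>L2. \<forall>g\<in>L2. \<forall>a b. ae_eq (T (\<lambda>x. a * f x + b * g x)) (\<lambda>x. a * T f x + b * T g x)) \<and>
     (\<exists>C. \<forall>f\<in>L2. L2_norm (T f) \<le> C * L2_norm f)"

definition is_adjoint :: "'a::euclidean_space operator \<Rightarrow> 'a operator \<Rightarrow> bool" where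
  "is_adjoint T S \<longleftrightarrow> bounded_operator S \<and>
     (\<forall>f\<in>L2. \<forall>g\<in>L2. L2_inner (T f) g = L2_inner f (S g))"

definition self_adjoint :: "'a::euclidean_space operator \<Rightarrow> bool" where
  "self_adjoint T \<longleftrightarrow> is_adjoint T T"

definition positive_operator :: "'a::euclidean_space operator \<Rightarrow> bool" where
  "positive_operator T \<longleftrightarrow> bounded_operator T \<and> (\<forall>f\<in>L2. L2_inner (T f) f \<in> \<real>\<^sub>\<ge>\<^sub>0)"

text \<open>\<open>A\<close> is the absolute value of \<open>T\<close>, the positive square root of \<open>T\<^sup>* T\<close>.\<close>

definition is_abs_operator :: "'a::euclidean_space operator \<Rightarrow> 'a operator \<Rightarrow> bool" where
  "is_abs_operator T A \<longleftrightarrow> positive_operator A \<and>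
     (\<exists>S. is_adjoint T S \<and> (\<forall>f\<in>L2. ae_eq (A (A f)) (S (T f))))"

definition trace_class :: "'a::euclidean_space operator \<Rightarrow> bool" where
  "trace_class T \<longleftrightarrow> bounded_operator T \<and>
     (\<exists>A B. is_abs_operator T A \<and> is_onb B \<and> (\<lambda>e. L2_inner (A e) e) summable_on B)"

text \<open>For trace-class operators the value does not depend on the chosen basis.\<close>

definition op_trace :: "'a::euclidean_space operator \<Rightarrow> complex" where
  "op_trace T = (\<Sum>\<^sub>\<infinity>e\<in>(SOME B. is_onb B). L2_inner (T e) e)"

definition density_operator :: "'a::euclidean_space operator \<Rightarrow> bool" where
  "density_operator T \<longleftrightarrow>
     trace_class T \<and> self_adjoint T \<and> positive_operator T \<and> op_trace T = 1"

text \<open>The range of \<open>T\<close>, modulo almost-everywhere equality, has dimension 1.\<close>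

definition rank_one :: "'a::euclidean_space operator \<Rightarrow> bool" where
  "rank_one T \<longleftrightarrow>
     (\<exists>h\<in>L2. \<not> ae_eq (T h) (\<lambda>x. 0) \<and> (\<forall>f\<in>L2. \<exists>c. ae_eq (T f) (\<lambda>x. c * T h x)))"

text \<open>
  A trace-class operator is Hilbert-Schmidt, hence has a square-integrable kernel, which is
  unique up to a null set of the product space.
\<close>

definition integral_kernel ::
    "'a::euclidean_space operator \<Rightarrow> ('a \<times> 'a \<Rightarrow> complex) \<Rightarrow> bool" where
  "integral_kernel T r \<longleftrightarrow> r \<in> L2 \<and> (\<forall>f\<in>L2. ae_eq (T f) (\<lambda>X. LINT Y|lborel. r (X, Y) * f Y))"

section \<open>Derivatives and distributions\<close>

definition dir_deriv ::
    "'a::euclidean_space \<Rightarrow> ('a \<Rightarrow> complex) \<Rightarrow> 'a \<Rightarrow> complex" where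
  "dir_deriv v f = (\<lambda>p. frechet_derivative f (at p) v)"

primrec Ck :: "nat \<Rightarrow> ('a::euclidean_space \<Rightarrow> complex) \<Rightarrow> bool" where
  "Ck 0 f \<longleftrightarrow> continuous_on UNIV f"
| "Ck (Suc k) f \<longleftrightarrow> (\<forall>p. f differentiable (at p)) \<and> (\<forall>v. Ck k (dir_deriv v f))"

definition test_functions :: "('a::euclidean_space \<Rightarrow> complex) set" where
  "test_functions = {\<phi>. (\<forall>k. Ck k \<phi>) \<and> (\<exists>K. compact K \<and> (\<forall>p. p \<notin> K \<longrightarrow> \<phi> p = 0))}"

text \<open>Distributions are handled as functionals, considered on test functions only.\<close>

type_synonym 'a functional = "('a \<Rightarrow> complex) \<Rightarrow> complex"

definition distr_of :: "('a::euclidean_space \<Rightarrow> complex) \<Rightarrow> 'a functional" where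
  "distr_of g = (\<lambda>\<phi>. LINT p|lborel. g p * \<phi> p)"

definition distr_deriv :: "'a::euclidean_space \<Rightarrow> 'a functional \<Rightarrow> 'a functional" where
  "distr_deriv v T = (\<lambda>\<phi>. - T (dir_deriv v \<phi>))"

definition distr_eq :: "'a::euclidean_space functional \<Rightarrow> 'a functional \<Rightarrow> bool" where
  "distr_eq S T \<longleftrightarrow> (\<forall>\<phi>\<in>test_functions. S \<phi> = T \<phi>)"

abbreviation dx :: "'n::finite \<Rightarrow> (real^'n) \<times> (real^'n)" where
  "dx j \<equiv> (axis j 1, 0)"

abbreviation dy :: "'n::finite \<Rightarrow> (real^'n) \<times> (real^'n)" where
  "dy j \<equiv> (0, axis j 1)"

section \<open>Wigner function and partial Fourier transform\<close>

text \<open>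
  \<open>r\<close> is the kernel of the operator. If the operator is trace class, the integral converges
  absolutely for almost every \<open>x\<close> and all \<open>\<xi>\<close>, and changing \<open>r\<close> on a null set changes
  the Wigner function only for a null set of \<open>x\<close>.
\<close>

definition wigner ::
    "real \<Rightarrow> ((real^'n) \<times> (real^'n) \<Rightarrow> complex) \<Rightarrow> (real^'n) \<times> (real^'n) \<Rightarrow> complex" where
  "wigner hbar r = (\<lambda>(x, \<xi>). 1 / (2 * complex_of_real pi) ^ CARD('n) *
     (LINT y|lborel. exp (- \<i> * complex_of_real (\<xi> \<bullet> y)) *
        r (x + (hbar / 2) *\<^sub>R y, x - (hbar / 2) *\<^sub>R y)))"

definition partial_fourier ::
    "((real^'n) \<times> (real^'n) \<Rightarrow> complex) \<Rightarrow> (real^'n) \<times> (real^'n) \<Rightarrow> complex" where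
  "partial_fourier \<phi> = (\<lambda>(x, \<eta>). LINT y|lborel. exp (- \<i> * complex_of_real (\<eta> \<bullet> y)) * \<phi> (x, y))"

text \<open>
  The Wigner function of a trace-class operator is square integrable but in general not
  integrable in \<open>\<xi>\<close>, so its Fourier integral need not converge and its partial Fourier
  transform is a distribution defined by transposition. \<open>F\<close> is a function representing it.
  Compactly supported test functions suffice: they are dense in the Schwartz space, so the
  tempered distribution is determined by its values on them.
\<close>

definition is_partial_fourier ::
    "((real^'n) \<times> (real^'n) \<Rightarrow> complex) \<Rightarrow> ((real^'n) \<times> (real^'n) \<Rightarrow> complex) \<Rightarrow> bool" where
  "is_partial_fourier W F \<longleftrightarrow>
     (\<forall>\<phi>\<in>test_functions.
        integrable lborel (\<lambda>p. W p * partial_fourier \<phi> p) \<and>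
        integrable lborel (\<lambda>p. F p * \<phi> p)) \<and>
     distr_eq (distr_of F) (\<lambda>\<phi>. distr_of W (partial_fourier \<phi>))"

end

theory Submission
  imports Defs "HOL-Probability.Characteristic_Functions"
begin

text \<open>
  Formally, \<open>F (x, y) = r (x - hbar y / 2, x + hbar y / 2)\<close>, so \<open>F\<close> is the kernel in midpoint and
  difference coordinates. In the kernel variables \<open>X\<close> and \<open>Y\<close> the two equations are the sum and the
  difference of \<open>\<partial>\<^sub>Y\<^sub>j (\<partial>\<^sub>X\<^sub>k K / K) = 0\<close> and \<open>\<partial>\<^sub>X\<^sub>j (\<partial>\<^sub>Y\<^sub>k K / K) = 0\<close>, where \<open>K (X, Y)\<close> is the continuous kernel.
  They say that the logarithmic derivatives of \<open>K\<close> in \<open>X\<close> do not depend on \<open>Y\<close> and vice versa, that is,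
  \<open>K (X, Y) K (X', Y') = K (X, Y') K (X', Y)\<close> for all points. This identity holds exactly for kernels
  \<open>a X * b Y\<close>, the kernels of operators of rank one. For such an operator, self-adjointness and unit
  trace imply positivity.

  Three points need work. First, \<open>F\<close> represents the partial Fourier transform only in the sense of
  distributions, and the Wigner integral may diverge for some \<open>x\<close>. Testing with products
  \<open>\<alpha> x * \<beta> y\<close> and inverting the Fourier transform in \<open>y\<close> with Gaussian regularization
  (\<open>fourier_pairing\<close>) shows that \<open>F\<close> is almost everywhere the kernel cut off to those \<open>x\<close> for which
  the integral converges; as \<open>F\<close> has no zeros, these are almost all \<open>x\<close> (\<open>partial_fourier_wigner\<close>).
  Second, \<open>F\<close> is only \<open>C\<^sup>1\<close>, so the second derivatives are distributions. The derivative of a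
  continuous function along \<open>v\<close> vanishes as a distribution if and only if the function is invariant
  under translations along \<open>v\<close> (\<open>distr_deriv_zero_iff_invariant\<close>), which turns the equations into the
  product identity (\<open>log_hess_equations_iff\<close>). Third, the identity is deduced from rank one pointwise,
  not only almost everywhere, by pairing with test functions (\<open>rank_one_imp_factorizes\<close>).

  All of this rests on smooth bump functions that approximate indicators of boxes and thereby
  determine a function almost everywhere (\<open>AE_zero_if_tested_zero\<close>).
\<close>

section \<open>Smooth functions\<close>

lemma dir_deriv_eq:
  "(f has_derivative f') (at p) \<Longrightarrow> dir_deriv v f p = f' v"
  unfolding dir_deriv_def using frechet_derivative_at by metis

lemma has_derivative_dir_deriv:
  "f differentiable (at p) \<Longrightarrow> (f has_derivative (\<lambda>v. dir_deriv v f p)) (at p)"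
  unfolding dir_deriv_def by (simp add: frechet_derivative_works)

lemma Ck_Suc_imp_Ck: "Ck (Suc k) f \<Longrightarrow> Ck k f"
proof (induction k arbitrary: f)
  case 0
  then show ?case
    by (auto intro!: differentiable_imp_continuous_on simp: differentiable_on_def)
next
  case (Suc k)
  then show ?case by (metis Ck.simps(2))
qed

lemma Ck_imp_continuous: "Ck k f \<Longrightarrow> continuous_on UNIV f"
  by (induction k) (use Ck_Suc_imp_Ck in auto)

lemma Ck_const [simp]: "Ck k (\<lambda>p. c)"
proof (induction k arbitrary: c)
  case (Suc k)
  have "dir_deriv v (\<lambda>p. c) = (\<lambda>p. 0)" for v :: 'a
    by (rule ext, rule dir_deriv_eq) (rule has_derivative_const)
  then show ?case using Suc by simp
qed simp

lemma Ck_add: "Ck k f \<Longrightarrow> Ck k g \<Longrightarrow> Ck k (\<lambda>p. f p + g p)"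
proof (induction k arbitrary: f g)
  case 0
  then show ?case by (auto intro: continuous_on_add)
next
  case (Suc k)
  have "dir_deriv v (\<lambda>p. f p + g p) = (\<lambda>p. dir_deriv v f p + dir_deriv v g p)" for v
    using Suc.prems
    by (intro ext dir_deriv_eq has_derivative_add has_derivative_dir_deriv) auto
  then show ?case using Suc by (auto intro!: Suc.IH)
qed

lemma Ck_mult: "Ck k f \<Longrightarrow> Ck k g \<Longrightarrow> Ck k (\<lambda>p. f p * g p)"
proof (induction k arbitrary: f g)
  case 0
  then show ?case by (auto intro: continuous_on_mult)
next
  case (Suc k)
  have "dir_deriv v (\<lambda>p. f p * g p) = (\<lambda>p. f p * dir_deriv v g p + dir_deriv v f p * g p)" for v
    using Suc.prems
    by (intro ext dir_deriv_eq has_derivative_mult has_derivative_dir_deriv) auto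
  moreover have "Ck k f" "Ck k g" using Suc.prems Ck_Suc_imp_Ck by blast+
  ultimately show ?case using Suc.prems by (auto intro!: Suc.IH Ck_add differentiable_mult)
qed

lemma Ck_prod: "(\<And>i. i \<in> I \<Longrightarrow> Ck k (f i)) \<Longrightarrow> Ck k (\<lambda>p. \<Prod>i\<in>I. f i p)"
  by (induction I rule: infinite_finite_induct) (auto intro!: Ck_mult)

lemma Ck_affine:
  assumes "bounded_linear L" and "Ck k f"
  shows "Ck k (\<lambda>p. f (L p + c))"
  using assms(2)
proof (induction k arbitrary: f)
  case 0
  have "continuous_on UNIV L"
    using assms(1) by (rule linear_continuous_on)
  then show ?case using 0
    by (auto intro!: continuous_intros continuous_on_compose2[of UNIV f])
next
  case (Suc k)
  have d: "((\<lambda>p. f (L p + c)) has_derivative (\<lambda>v. dir_deriv (L v) f (L p + c))) (at p)" for p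
  proof -
    have "((\<lambda>p. L p + c) has_derivative L) (at p)"
      by (auto intro!: derivative_eq_intros bounded_linear.has_derivative[OF assms(1)])
    from has_derivative_compose[OF this has_derivative_dir_deriv, of f]
    show ?thesis using Suc.prems by simp
  qed
  have "dir_deriv v (\<lambda>p. f (L p + c)) = (\<lambda>p. dir_deriv (L v) f (L p + c))" for v
    by (intro ext dir_deriv_eq d)
  then show ?case using Suc d by (auto simp: differentiable_def)
qed

text \<open>
  The functions \<open>exp (-1/t) / t ^ k\<close>, extended by zero to \<open>t \<le> 0\<close>. Up to linear combinations
  the family is closed under differentiation, so all its members are smooth.
\<close>

definition flat_exp :: "nat \<Rightarrow> real \<Rightarrow> real" where
  "flat_exp k t = (if t > 0 then exp (- 1 / t) / t ^ k else 0)"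

lemma flat_exp_tendsto_0: "(flat_exp k \<longlongrightarrow> 0) (at 0)"
proof -
  have "((\<lambda>u. u ^ k / exp u) \<longlongrightarrow> (0::real)) at_top"
    by (rule tendsto_power_div_exp_0)
  then have "((\<lambda>u. flat_exp k (inverse u)) \<longlongrightarrow> 0) at_top"
    by (rule Lim_transform_eventually)
      (auto intro!: eventually_mono[OF eventually_gt_at_top[of 0]]
        simp: flat_exp_def exp_minus field_simps)
  then have "(flat_exp k \<longlongrightarrow> 0) (at_right 0)"
    by (simp add: filterlim_at_right_to_top)
  moreover have "(flat_exp k \<longlongrightarrow> 0) (at_left 0)"
    by (rule Lim_transform_eventually[OF tendsto_const])
      (auto simp: flat_exp_def eventually_at intro!: exI[of _ 1])
  ultimately show ?thesis by (simp add: filterlim_split_at)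
qed

lemma flat_exp_has_derivative:
  "(flat_exp k has_real_derivative (- real k * flat_exp (Suc k) t + flat_exp (Suc (Suc k)) t)) (at t)"
proof (cases t "0 :: real" rule: linorder_cases)
  case less
  have "((\<lambda>t. 0) has_real_derivative 0) (at t)" by simp
  then have "(flat_exp k has_real_derivative 0) (at t)"
    by (rule has_field_derivative_transform_within[where d = "-t"]) (use less in \<open>auto simp: flat_exp_def dist_real_def\<close>)
  then show ?thesis using less by (simp add: flat_exp_def)
next
  case equal
  have "((\<lambda>h. (flat_exp k (0 + h) - flat_exp k 0) / h) \<longlongrightarrow> 0) (at 0)"
    by (rule Lim_transform_eventually[OF flat_exp_tendsto_0[of "Suc k"]])
      (auto simp: flat_exp_def eventually_at intro!: exI[of _ 1])
  then show ?thesis using equal by (simp add: flat_exp_def DERIV_def)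
next
  case greater
  have "((\<lambda>t. exp (- 1 / t) * inverse (t ^ k)) has_real_derivative
      exp (- 1 / t) * (1 / t\<^sup>2) * inverse (t ^ k)
        + exp (- 1 / t) * (- (inverse (t ^ k) * (real k * t ^ (k - Suc 0)) * inverse (t ^ k)))) (at t)"
    using greater
    by (auto intro!: derivative_eq_intros simp: power2_eq_square divide_inverse)
  moreover have "inverse (t ^ k) * (real k * t ^ (k - Suc 0)) * inverse (t ^ k)
      = real k / t ^ Suc k"
    using greater by (cases k) (simp_all add: field_simps)
  moreover have "exp (- 1 / t) * (1 / t\<^sup>2) * inverse (t ^ k) = flat_exp (Suc (Suc k)) t"
    using greater by (simp add: flat_exp_def power2_eq_square field_simps)
  moreover have "exp (- 1 / t) * - (real k / t ^ Suc k) = - real k * flat_exp (Suc k) t"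
    using greater by (simp add: flat_exp_def)
  ultimately have "((\<lambda>t. exp (- 1 / t) / t ^ k) has_real_derivative
      (- real k * flat_exp (Suc k) t + flat_exp (Suc (Suc k)) t)) (at t)"
    by (simp only: divide_inverse add.commute)
  then show ?thesis
    by (rule has_field_derivative_transform_within[where d = t]) (use greater in \<open>auto simp: flat_exp_def dist_real_def\<close>)
qed

lemma Ck_flat: "Ck m (\<lambda>p. complex_of_real (flat_exp k (p \<bullet> u + c)))"
proof (induction m arbitrary: k)
  case 0
  have "continuous_on UNIV (flat_exp k)"
    using flat_exp_has_derivative by (meson DERIV_continuous continuous_at_imp_continuous_on)
  then show ?case
    by (auto intro!: continuous_intros continuous_on_compose2[of UNIV "flat_exp k"])
next
  case (Suc m)
  have d: "((\<lambda>p. complex_of_real (flat_exp k (p \<bullet> u + c))) has_derivative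
     (\<lambda>v. complex_of_real (v \<bullet> u) * (- of_nat k * complex_of_real (flat_exp (Suc k) (p \<bullet> u + c))
        + complex_of_real (flat_exp (Suc (Suc k)) (p \<bullet> u + c))))) (at p)" for p
  proof -
    have "((\<lambda>p. p \<bullet> u + c) has_derivative (\<lambda>v. v \<bullet> u)) (at p)"
      by (auto intro!: derivative_eq_intros)
    from has_derivative_of_real[OF has_derivative_compose[OF this
      flat_exp_has_derivative[unfolded has_field_derivative_def]]]
    show ?thesis by (simp add: mult.commute)
  qed
  have "dir_deriv v (\<lambda>p. complex_of_real (flat_exp k (p \<bullet> u + c))) =
     (\<lambda>p. complex_of_real (v \<bullet> u) * (- of_nat k * complex_of_real (flat_exp (Suc k) (p \<bullet> u + c))
        + complex_of_real (flat_exp (Suc (Suc k)) (p \<bullet> u + c))))" for v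
    by (intro ext dir_deriv_eq[OF d])
  moreover have "Ck m (\<lambda>p. complex_of_real (v \<bullet> u) *
      (- of_nat k * complex_of_real (flat_exp (Suc k) (p \<bullet> u + c))
        + complex_of_real (flat_exp (Suc (Suc k)) (p \<bullet> u + c))))" for v
    by (intro Ck_add Ck_mult Ck_const Suc)
  ultimately show ?case using d by (auto simp: differentiable_def simp del: of_real_mult)
qed

section \<open>Test functions\<close>

lemma continuous_test: "\<phi> \<in> test_functions \<Longrightarrow> continuous_on UNIV \<phi>"
  by (auto simp: test_functions_def intro: Ck_imp_continuous)

lemma measurable_test [measurable]: "\<phi> \<in> test_functions \<Longrightarrow> \<phi> \<in> borel_measurable borel"
  by (intro borel_measurable_continuous_onI continuous_test)

lemma differentiable_test: "\<phi> \<in> test_functions \<Longrightarrow> \<phi> differentiable (at p)"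
  unfolding test_functions_def by (metis (mono_tags, lifting) Ck.simps(2) mem_Collect_eq)

lemma test_dir_deriv:
  assumes "\<phi> \<in> test_functions"
  shows "dir_deriv v \<phi> \<in> test_functions"
proof -
  from assms obtain K where K: "compact K" "\<And>p. p \<notin> K \<Longrightarrow> \<phi> p = 0" and C: "\<And>k. Ck k \<phi>"
    by (auto simp: test_functions_def)
  have "dir_deriv v \<phi> p = 0" if "p \<notin> K" for p
  proof -
    have "((\<lambda>p. 0 :: complex) has_derivative (\<lambda>v. 0)) (at p)" by (rule has_derivative_const)
    then have "(\<phi> has_derivative (\<lambda>v. 0)) (at p)"
      by (rule has_derivative_transform_within_open[where s = "- K"])
         (use that K in \<open>auto simp: compact_imp_closed open_Compl\<close>)
    then show ?thesis by (rule dir_deriv_eq)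
  qed
  moreover have "Ck k (dir_deriv v \<phi>)" for k using C[of "Suc k"] by simp
  ultimately show ?thesis using K(1) by (auto simp: test_functions_def)
qed

lemma test_mult:
  assumes "\<phi> \<in> test_functions" "\<psi> \<in> test_functions"
  shows "(\<lambda>p. \<phi> p * \<psi> p) \<in> test_functions"
proof -
  from assms(1) obtain K where K: "compact K" "\<And>p. p \<notin> K \<Longrightarrow> \<phi> p = 0" and C: "\<And>k. Ck k \<phi>"
    by (auto simp: test_functions_def)
  have "\<And>k. Ck k \<psi>" using assms(2) by (auto simp: test_functions_def)
  with C have "\<And>k. Ck k (\<lambda>p. \<phi> p * \<psi> p)" by (intro Ck_mult)
  moreover have "\<forall>p. p \<notin> K \<longrightarrow> \<phi> p * \<psi> p = 0" using K(2) by simp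
  ultimately show ?thesis using K(1) unfolding test_functions_def by blast
qed

lemma test_translate:
  assumes "\<phi> \<in> test_functions"
  shows "(\<lambda>p. \<phi> (p + c)) \<in> test_functions"
proof -
  from assms obtain K where K: "compact K" "\<And>p. p \<notin> K \<Longrightarrow> \<phi> p = 0" and C: "\<And>k. Ck k \<phi>"
    by (auto simp: test_functions_def)
  have "compact ((+) (- c) ` K)" using K(1) by (rule compact_translation)
  moreover have "\<phi> (p + c) = 0" if "p \<notin> (+) (- c) ` K" for p
  proof -
    have "p = - c + (p + c)" by simp
    then have "p + c \<notin> K" using that by blast
    then show ?thesis by (rule K)
  qed
  ultimately show ?thesis
    using C by (auto simp: test_functions_def intro!: Ck_affine[OF bounded_linear_ident])
qed

lemma test_tensor:
  assumes "\<alpha> \<in> test_functions" "\<beta> \<in> test_functions"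
  shows "(\<lambda>(x, y). \<alpha> x * \<beta> y) \<in> test_functions"
proof -
  from assms(1) obtain K where K: "compact K" "\<And>p. p \<notin> K \<Longrightarrow> \<alpha> p = 0" and C: "\<And>k. Ck k \<alpha>"
    by (auto simp: test_functions_def)
  from assms(2) obtain K' where K': "compact K'" "\<And>p. p \<notin> K' \<Longrightarrow> \<beta> p = 0" and C': "\<And>k. Ck k \<beta>"
    by (auto simp: test_functions_def)
  have "Ck k (\<lambda>p. \<alpha> (fst p) * \<beta> (snd p))" for k
    using Ck_affine[OF bounded_linear_fst C[of k], of 0]
          Ck_affine[OF bounded_linear_snd C'[of k], of 0] by (intro Ck_mult) auto
  then have "Ck k (\<lambda>(x, y). \<alpha> x * \<beta> y)" for k by (simp add: case_prod_unfold)
  moreover have "compact (K \<times> K')" using K(1) K'(1) by (rule compact_Times)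
  ultimately show ?thesis using K(2) K'(2)
    by (auto simp: test_functions_def intro!: exI[of _ "K \<times> K'"])
qed

lemma compact_support_bounded:
  fixes \<phi> :: "'a::euclidean_space \<Rightarrow> complex"
  assumes "continuous_on UNIV \<phi>" "compact K" "\<And>p. p \<notin> K \<Longrightarrow> \<phi> p = 0"
  obtains C where "C \<ge> 0" "\<And>p. cmod (\<phi> p) \<le> C"
proof -
  have "compact (\<phi> ` K)"
    using assms by (intro compact_continuous_image) (auto intro: continuous_on_subset)
  then have "bounded (\<phi> ` K)" by (rule compact_imp_bounded)
  then obtain B where B: "\<And>p. p \<in> K \<Longrightarrow> cmod (\<phi> p) \<le> B"
    by (auto simp: bounded_iff)
  have "cmod (\<phi> p) \<le> max 0 B" for p
    using B[of p] assms(3)[of p] by (cases "p \<in> K") auto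
  then show ?thesis using that[of "max 0 B"] by auto
qed

lemma integrable_compact_support:
  fixes g :: "'a::euclidean_space \<Rightarrow> complex"
  assumes "continuous_on UNIV g" "compact K" "\<And>p. p \<notin> K \<Longrightarrow> g p = 0"
  shows "integrable lborel g"
proof -
  have "set_integrable lborel K g"
    unfolding set_integrable_def using assms
    by (intro borel_integrable_compact) (auto intro: continuous_on_subset)
  moreover have "(\<lambda>x. indicator K x *\<^sub>R g x) = g"
    using assms(3) by (auto simp: fun_eq_iff indicator_def)
  ultimately show ?thesis unfolding set_integrable_def by simp
qed

lemma integrable_continuous_test:
  assumes "continuous_on UNIV g" "\<phi> \<in> test_functions"
  shows "integrable lborel (\<lambda>p. g p * \<phi> p)"
proof -
  from assms(2) obtain K where K: "compact K" "\<And>p. p \<notin> K \<Longrightarrow> \<phi> p = 0"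
    by (auto simp: test_functions_def)
  then show ?thesis
    using assms continuous_test[OF assms(2)]
    by (intro integrable_compact_support[where K = K] continuous_on_mult) auto
qed

lemma test_in_L2:
  assumes "\<phi> \<in> test_functions"
  shows "\<phi> \<in> L2"
proof -
  from assms obtain K where K: "compact K" "\<And>p. p \<notin> K \<Longrightarrow> \<phi> p = 0"
    by (auto simp: test_functions_def)
  have "integrable lborel (\<lambda>p. complex_of_real ((cmod (\<phi> p))\<^sup>2))"
    using K continuous_test[OF assms]
    by (intro integrable_compact_support[where K = K]) (auto intro!: continuous_intros)
  then have "integrable lborel (\<lambda>p. (cmod (\<phi> p))\<^sup>2)"
    using integrable_Re[of lborel "\<lambda>p. complex_of_real ((cmod (\<phi> p))\<^sup>2)"] by simp
  then show ?thesis using assms by (simp add: L2_def)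
qed

text \<open>
  Test functions with values in \<open>[0, 1]\<close> that are positive exactly on the open box with corners \<open>a\<close>
  and \<open>b\<close> and converge to its indicator as \<open>m \<rightarrow> \<infinity>\<close>. No normalization is needed, since
  \<open>exp (-1/t)\<close> tends to 1 as \<open>t \<rightarrow> \<infinity>\<close>; the factor \<open>Suc m\<close> keeps the scale positive.
\<close>

definition bump :: "'a::euclidean_space \<Rightarrow> 'a \<Rightarrow> nat \<Rightarrow> 'a \<Rightarrow> complex" where
  "bump a b m p = (\<Prod>i\<in>Basis. complex_of_real (flat_exp 0 (real (Suc m) * (p \<bullet> i - a \<bullet> i)))
     * complex_of_real (flat_exp 0 (real (Suc m) * (b \<bullet> i - p \<bullet> i))))"

lemma bump_outside: "p \<notin> box a b \<Longrightarrow> bump a b m p = 0"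
  unfolding bump_def box_def
  by (auto simp: flat_exp_def intro!: prod_zero) (force simp: zero_less_mult_iff)+

lemma bump_pos: "p \<in> box a b \<Longrightarrow> bump a b m p \<noteq> 0"
  unfolding bump_def box_def by (auto simp: flat_exp_def zero_less_mult_iff)

lemma norm_bump_le_1: "cmod (bump a b m p) \<le> 1"
proof -
  have *: "\<bar>flat_exp 0 t\<bar> \<le> 1" for t by (auto simp: flat_exp_def)
  show ?thesis unfolding bump_def norm_mult prod_norm[symmetric]
    by (intro prod_le_1) (auto intro!: mult_le_one *)
qed

lemma bump_tendsto: "(\<lambda>m. bump a b m p) \<longlonglongrightarrow> indicator (box a b) p"
proof (cases "p \<in> box a b")
  case False
  then show ?thesis by (simp add: bump_outside)
next
  case True
  have *: "(\<lambda>m. flat_exp 0 (real (Suc m) * s)) \<longlonglongrightarrow> 1" if "s > 0" for s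
  proof -
    have "(\<lambda>m. exp (- (inverse s * inverse (real (Suc m))))) \<longlonglongrightarrow> exp (- (inverse s * 0))"
      by (intro tendsto_intros LIMSEQ_inverse_real_of_nat)
    then show ?thesis using that by (simp add: flat_exp_def divide_inverse mult.commute)
  qed
  have "(\<lambda>m. bump a b m p) \<longlonglongrightarrow> (\<Prod>i\<in>(Basis::'a set). complex_of_real 1 * complex_of_real 1)"
    unfolding bump_def using True
    by (intro tendsto_intros *) (auto simp: box_def)
  then show ?thesis using True by simp
qed

lemma bump_test: "bump a b m \<in> test_functions"
proof -
  have "Ck k (bump a b m)" for k
  proof -
    have "real (Suc m) * (p \<bullet> i - a \<bullet> i) = p \<bullet> (real (Suc m) *\<^sub>R i) + - real (Suc m) * (a \<bullet> i)"
      "real (Suc m) * (b \<bullet> i - p \<bullet> i) = p \<bullet> (- real (Suc m) *\<^sub>R i) + real (Suc m) * (b \<bullet> i)" for p i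
      by (simp_all add: algebra_simps)
    then show ?thesis unfolding bump_def [abs_def]
      by (simp only:) (intro Ck_prod Ck_mult Ck_flat)
  qed
  moreover have "p \<notin> cbox a b \<Longrightarrow> bump a b m p = 0" for p
    using box_subset_cbox bump_outside by blast
  ultimately show ?thesis unfolding test_functions_def using compact_cbox by blast
qed

lemma bump_prod:
  "bump (a, a') (b, b') m (x, y) = bump a b m x * bump a' b' m y"
proof -
  have disj: "(\<lambda>u. (u, 0 :: 'b)) ` (Basis :: 'a set) \<inter> (\<lambda>v. (0, v)) ` (Basis :: 'b set) = {}"
    by auto
  have inj: "inj_on (\<lambda>u. (u, 0 :: 'b)) (Basis :: 'a set)" "inj_on (\<lambda>v. (0 :: 'a, v)) (Basis :: 'b set)"
    by (auto simp: inj_on_def)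
  show ?thesis
    unfolding bump_def Basis_prod_def
      prod.union_disjoint[OF finite_imageI[OF finite_Basis] finite_imageI[OF finite_Basis] disj]
      prod.reindex[OF inj(1)] prod.reindex[OF inj(2)]
    by (simp add: o_def)
qed

section \<open>Functions that vanish when tested\<close>

lemma AE_zero_if_box_integrals_zero:
  fixes f :: "'a::euclidean_space \<Rightarrow> complex"
  assumes int: "integrable lborel f"
    and box: "\<And>a b. (LINT x|lborel. indicator (box a b) x * f x) = 0"
  shows "AE x in lborel. f x = 0"
proof -
  have I: "integrable lborel (\<lambda>x. indicator A x * f x)" if "A \<in> sets borel" for A
  proof -
    have "(\<lambda>x. indicator A x *\<^sub>R f x) = (\<lambda>x. indicator A x * f x)"
      by (auto simp: indicator_def)
    then show ?thesis using integrable_mult_indicator[of A lborel f] that int by simp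
  qed
  have set_int: "(LINT x:B|lborel. f x) = (LINT x|lborel. indicator B x * f x)" for B
    unfolding set_lebesgue_integral_def
    by (rule Bochner_Integration.integral_cong) (auto simp: indicator_def)
  let ?P = "\<lambda>A. (LINT x|lborel. indicator A x * f x) = 0"
  let ?B = "\<lambda>n::nat. box (- (real n *\<^sub>R One)) (real n *\<^sub>R One) :: 'a set"
  have total: "(LINT x|lborel. f x) = 0"
  proof -
    have "(\<lambda>n. LINT x|lborel. indicator (?B n) x * f x) \<longlonglongrightarrow> (LINT x|lborel. f x)"
    proof (rule integral_dominated_convergence[where w = "\<lambda>x. cmod (f x)"])
      show "AE x in lborel. (\<lambda>n. indicator (?B n) x * f x) \<longlonglongrightarrow> f x"
      proof (rule AE_I2)
        fix x :: 'a
        have "x \<in> (\<Union>n. ?B n)" using UN_box_eq_UNIV by auto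
        then obtain N where N: "x \<in> ?B N" by auto
        have "x \<in> ?B n" if "n \<ge> N" for n
        proof -
          have "real N \<le> real n" using that by simp
          with N show ?thesis by (force simp: box_def)
        qed
        then have "\<forall>\<^sub>F n in sequentially. indicator (?B n) x * f x = f x"
          unfolding eventually_sequentially by (intro exI[of _ N]) (auto simp: indicator_def)
        then show "(\<lambda>n. indicator (?B n) x * f x) \<longlonglongrightarrow> f x"
          by (rule tendsto_eventually)
      qed
    qed (use int in \<open>auto simp: norm_mult indicator_def\<close>)
    then show ?thesis using box by (simp add: LIMSEQ_const_iff)
  qed
  have "?P A" if "A \<in> sets borel" for A
  proof -
    let ?G = "range (\<lambda>(a, b). box a b :: 'a set)"
    have "Int_stable ?G" by (auto simp: Int_stable_def box_Int_box)
    moreover have "?G \<subseteq> Pow UNIV" by simp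
    moreover have "A \<in> sigma_sets UNIV ?G" using that by (simp add: borel_eq_box)
    ultimately show ?thesis
    proof (induction rule: sigma_sets_induct_disjoint)
      case (compl A)
      then have A: "A \<in> sets borel" by (simp add: borel_eq_box)
      have "(LINT x|lborel. indicator (UNIV - A) x * f x)
          = (LINT x|lborel. f x - indicator A x * f x)"
        by (rule Bochner_Integration.integral_cong) (auto simp: indicator_def)
      also have "\<dots> = 0" using int I[OF A] compl total by simp
      finally show ?case .
    next
      case (union A)
      then have A: "\<And>i. A i \<in> sets borel" by (auto simp: borel_eq_box)
      have "(LINT x:(\<Union>i. A i)|lborel. f x) = (\<Sum>i. (LINT x:A i|lborel. f x))"
        using union(1) A int
        by (intro lebesgue_integral_countable_add)
          (auto simp: disjoint_family_on_def set_integrable_def intro!: integrable_mult_indicator)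
      then show ?case using union set_int by simp
    qed (use box in auto)
  qed
  then show ?thesis
    by (intro sigma_finite_measure.density_zero[OF sigma_finite_lborel] int)
       (simp add: set_int)
qed

text \<open>
  The hypothesis on \<open>\<Phi>\<close> covers both the space of all test functions and, on a product space, the
  products of two test functions. Local integrability is not assumed: multiplying \<open>f\<close> by a fixed
  member of \<open>\<Phi>\<close> that does not vanish on a large box makes it integrable.
\<close>

lemma AE_zero_if_tested_zero:
  fixes f :: "'a::euclidean_space \<Rightarrow> complex"
  assumes bump: "\<And>a b m. bump a b m \<in> \<Phi>"
    and mult: "\<And>\<phi> \<psi>. \<phi> \<in> \<Phi> \<Longrightarrow> \<psi> \<in> \<Phi> \<Longrightarrow> (\<lambda>p. \<phi> p * \<psi> p) \<in> \<Phi>"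
    and int: "\<And>\<phi>. \<phi> \<in> \<Phi> \<Longrightarrow> integrable lborel (\<lambda>p. f p * \<phi> p)"
    and zero: "\<And>\<phi>. \<phi> \<in> \<Phi> \<Longrightarrow> (LINT p|lborel. f p * \<phi> p) = 0"
  shows "AE p in lborel. f p = 0"
proof -
  \<comment> \<open>Cutoff functions, nonzero on boxes that exhaust the space\<close>
  let ?c = "\<lambda>n::nat. bump (- (real n *\<^sub>R One)) (real n *\<^sub>R One) 0 :: 'a \<Rightarrow> complex"
  have "AE p in lborel. f p * ?c n p = 0" for n
  proof (rule AE_zero_if_box_integrals_zero)
    show i: "integrable lborel (\<lambda>p. f p * ?c n p)" by (intro int bump)
    fix a b :: 'a
    have "(\<lambda>m. LINT p|lborel. bump a b m p * (f p * ?c n p))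
       \<longlonglongrightarrow> (LINT p|lborel. indicator (box a b) p * (f p * ?c n p))"
    proof (rule integral_dominated_convergence[where w = "\<lambda>p. cmod (f p * ?c n p)"])
      show "AE p in lborel. (\<lambda>m. bump a b m p * (f p * ?c n p))
          \<longlonglongrightarrow> indicator (box a b) p * (f p * ?c n p)"
        by (intro AE_I2 tendsto_intros bump_tendsto)
      show "AE p in lborel. norm (bump a b m p * (f p * ?c n p)) \<le> cmod (f p * ?c n p)" for m
        by (rule AE_I2, subst norm_mult)
           (intro mult_left_le_one_le norm_bump_le_1 norm_ge_zero)
      have [measurable]: "(\<lambda>p. f p * ?c n p) \<in> borel_measurable borel"
        using borel_measurable_integrable[OF i] by simp
      show "(\<lambda>p. bump a b m p * (f p * ?c n p)) \<in> borel_measurable lborel" for m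
        using measurable_test[OF bump_test[of a b m]] by simp
    qed (use i in auto)
    moreover have "(LINT p|lborel. bump a b m p * (f p * ?c n p)) = 0" for m
      using zero[OF mult[OF bump bump], of "- (real n *\<^sub>R One)" "real n *\<^sub>R One" 0 a b m]
      by (simp add: ac_simps)
    ultimately show "(LINT p|lborel. indicator (box a b) p * (f p * ?c n p)) = 0"
      by (simp add: LIMSEQ_const_iff)
  qed
  then have "AE p in lborel. \<forall>n. f p * ?c n p = 0" unfolding AE_all_countable by blast
  then show ?thesis
  proof eventually_elim
    case (elim p)
    have "p \<in> (\<Union>n. box (- (real n *\<^sub>R One)) (real n *\<^sub>R One))" using UN_box_eq_UNIV by auto
    then obtain n where "p \<in> box (- (real n *\<^sub>R One)) (real n *\<^sub>R One)" by auto
    from bump_pos[OF this] elim show ?case by (metis mult_eq_0_iff)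
  qed
qed

lemma AE_eq_continuous_imp_eq:
  fixes f g :: "'a::euclidean_space \<Rightarrow> complex"
  assumes "AE p in lborel. f p = g p" "continuous_on UNIV f" "continuous_on UNIV g"
  shows "f p = g p"
proof -
  have "closed {p. f p = g p}" using assms(2,3) by (intro closed_Collect_eq) auto
  from mem_closed_if_AE_lebesgue[OF this, of p] show ?thesis
    using assms(1) by (auto dest: AE_completion)
qed

lemma continuous_zero_if_tested_zero:
  fixes g :: "'a::euclidean_space \<Rightarrow> complex"
  assumes "continuous_on UNIV g"
    and "\<And>\<phi>. \<phi> \<in> test_functions \<Longrightarrow> (LINT p|lborel. g p * \<phi> p) = 0"
  shows "g p = 0"
proof -
  have "AE p in lborel. g p = 0"
    by (rule AE_zero_if_tested_zero[of test_functions])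
       (use assms in \<open>auto intro: bump_test test_mult integrable_continuous_test\<close>)
  from AE_eq_continuous_imp_eq[OF this assms(1)] show ?thesis by simp
qed

lemma AE_zero_if_tensor_tested_zero:
  fixes f :: "'a::euclidean_space \<times> 'b::euclidean_space \<Rightarrow> complex"
  assumes "\<And>\<alpha> \<beta>. \<alpha> \<in> test_functions \<Longrightarrow> \<beta> \<in> test_functions
       \<Longrightarrow> integrable lborel (\<lambda>p. f p * (\<alpha> (fst p) * \<beta> (snd p)))"
    and "\<And>\<alpha> \<beta>. \<alpha> \<in> test_functions \<Longrightarrow> \<beta> \<in> test_functions
       \<Longrightarrow> (LINT p|lborel. f p * (\<alpha> (fst p) * \<beta> (snd p))) = 0"
  shows "AE p in lborel. f p = 0"
proof (rule AE_zero_if_tested_zero)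
  let ?t = "\<lambda>\<phi> :: 'a \<times> 'b \<Rightarrow> complex. \<exists>\<alpha> \<beta>. \<alpha> \<in> test_functions \<and> \<beta> \<in> test_functions
    \<and> \<phi> = (\<lambda>p. \<alpha> (fst p) * \<beta> (snd p))"
  {
    fix a b :: "'a \<times> 'b" and m
    have "bump a b m = (\<lambda>p. bump (fst a) (fst b) m (fst p) * bump (snd a) (snd b) m (snd p))"
      by (rule ext) (metis bump_prod prod.collapse)
    then show "bump a b m \<in> Collect ?t"
      unfolding mem_Collect_eq
      by (intro exI[of _ "bump (fst a) (fst b) m"] exI[of _ "bump (snd a) (snd b) m"])
        (simp add: bump_test)
  next
    fix \<phi> \<psi> assume "\<phi> \<in> Collect ?t" "\<psi> \<in> Collect ?t"
    then obtain \<alpha> \<beta> \<alpha>' \<beta>' where t: "\<alpha> \<in> test_functions" "\<beta> \<in> test_functions"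
        "\<alpha>' \<in> test_functions" "\<beta>' \<in> test_functions"
      and eq: "\<phi> = (\<lambda>p. \<alpha> (fst p) * \<beta> (snd p))" "\<psi> = (\<lambda>p. \<alpha>' (fst p) * \<beta>' (snd p))"
      unfolding mem_Collect_eq by (elim exE conjE)
    have "(\<lambda>p. \<phi> p * \<psi> p)
        = (\<lambda>p. (\<lambda>x. \<alpha> x * \<alpha>' x) (fst p) * (\<lambda>y. \<beta> y * \<beta>' y) (snd p))"
      unfolding eq by (simp add: ac_simps)
    then show "(\<lambda>p. \<phi> p * \<psi> p) \<in> Collect ?t"
      unfolding mem_Collect_eq
      by (intro exI[of _ "\<lambda>x. \<alpha> x * \<alpha>' x"] exI[of _ "\<lambda>y. \<beta> y * \<beta>' y"])
        (simp add: test_mult t)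
  next
    fix \<phi> assume "\<phi> \<in> Collect ?t"
    then show "integrable lborel (\<lambda>p. f p * \<phi> p)" "(LINT p|lborel. f p * \<phi> p) = 0"
      using assms by auto
  }
qed


section \<open>Integration on Euclidean spaces\<close>

lemma AE_lborel_prodD:
  fixes Q :: "'a::euclidean_space \<times> 'b::euclidean_space \<Rightarrow> bool"
  assumes "AE p in lborel. Q p"
  shows "AE x in lborel. AE y in lborel. Q (x, y)"
  using lborel_pair.AE_pair assms unfolding lborel_prod by blast

lemma integrable_lborel_prodD:
  fixes f :: "'a::euclidean_space \<times> 'b::euclidean_space \<Rightarrow> complex"
  assumes "integrable lborel f"
  shows "AE x in lborel. integrable lborel (\<lambda>y. f (x, y))"
    and "integrable lborel (\<lambda>x. LINT y|lborel. f (x, y))"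
    and "(LINT x|lborel. LINT y|lborel. f (x, y)) = (LINT p|lborel. f p)"
  using assms lborel_pair.AE_integrable_fst'[of f] lborel_pair.integrable_fst'[of f]
    lborel_pair.integral_fst'[of f] unfolding lborel_prod by blast+

lemma integrable_lborel_tensor:
  fixes f :: "'a::euclidean_space \<Rightarrow> complex" and g :: "'b::euclidean_space \<Rightarrow> complex"
  assumes f: "integrable lborel f" and g: "integrable lborel g"
  shows "integrable (lborel \<Otimes>\<^sub>M lborel) (\<lambda>(x, y). f x * g y)"
proof (rule lborel_pair.Fubini_integrable)
  have [measurable]: "f \<in> borel_measurable borel" "g \<in> borel_measurable borel"
    using f g by (auto dest: borel_measurable_integrable)
  show "(\<lambda>(x, y). f x * g y) \<in> borel_measurable (lborel \<Otimes>\<^sub>M lborel)"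
    by measurable
  show "integrable lborel (\<lambda>x. LINT y|lborel. norm (case (x, y) of (x, y) \<Rightarrow> f x * g y))"
    using f by (simp add: norm_mult)
  show "AE x in lborel. integrable lborel (\<lambda>y. case (x, y) of (x, y) \<Rightarrow> f x * g y)"
    using g by simp
qed

lemma lborel_nn_integral_affine:
  fixes f :: "'a::euclidean_space \<Rightarrow> ennreal"
  assumes [measurable]: "f \<in> borel_measurable borel" and "c \<noteq> 0"
  shows "(\<integral>\<^sup>+x. f x \<partial>lborel) = ennreal (\<bar>c\<bar> ^ DIM('a)) * (\<integral>\<^sup>+x. f (t + c *\<^sub>R x) \<partial>lborel)"
  by (subst lborel_affine[OF assms(2), of t])
     (simp add: nn_integral_density nn_integral_distr nn_integral_cmult)

lemma lborel_integrable_affine: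
  fixes f :: "'a::euclidean_space \<Rightarrow> complex"
  assumes f: "integrable lborel f" and c: "c \<noteq> 0"
  shows "integrable lborel (\<lambda>x. f (t + c *\<^sub>R x))"
proof -
  have [measurable]: "f \<in> borel_measurable borel" using f by (auto dest: borel_measurable_integrable)
  have "(\<integral>\<^sup>+x. norm (f x) \<partial>lborel) < \<infinity>" using f by (simp add: integrable_iff_bounded)
  then show ?thesis
    using c lborel_nn_integral_affine[of "\<lambda>x. norm (f x)" c t]
    by (auto simp: integrable_iff_bounded ennreal_mult_less_top)
qed

lemma lborel_integral_affine:
  fixes f :: "'a::euclidean_space \<Rightarrow> complex"
  assumes c: "c \<noteq> 0" and f: "f \<in> borel_measurable borel"
  shows "(LINT x|lborel. f x) = complex_of_real (\<bar>c\<bar> ^ DIM('a)) * (LINT x|lborel. f (t + c *\<^sub>R x))"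
proof -
  have [measurable]: "f \<in> borel_measurable borel" by fact
  have "(LINT x|lborel. f x) = (LINT x|density (distr lborel borel (\<lambda>x. t + c *\<^sub>R x)) (\<lambda>_. \<bar>c\<bar> ^ DIM('a)). f x)"
    using lborel_affine[OF c, of t] by simp
  also have "\<dots> = (LINT x|distr lborel borel (\<lambda>x. t + c *\<^sub>R x). \<bar>c\<bar> ^ DIM('a) *\<^sub>R f x)"
    by (rule integral_density) simp_all
  also have "\<dots> = (LINT x|lborel. \<bar>c\<bar> ^ DIM('a) *\<^sub>R f (t + c *\<^sub>R x))"
    by (rule integral_distr) simp_all
  finally show ?thesis by (simp add: scaleR_conv_of_real)
qed

lemma lborel_prod_integrable_integral:
  fixes f :: "'a::euclidean_space \<Rightarrow> real \<Rightarrow> complex"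
  assumes int: "\<And>i. i \<in> Basis \<Longrightarrow> integrable lborel (f i)"
  shows "integrable lborel (\<lambda>x. \<Prod>i\<in>Basis. f i (x \<bullet> i))"
    and "(LINT x|lborel. (\<Prod>i\<in>Basis. f i (x \<bullet> i))) = (\<Prod>i\<in>Basis. (LINT t|lborel. f i t))"
proof -
  interpret product_sigma_finite "\<lambda>_::'a. lborel :: real measure" by standard
  have [measurable]: "\<And>i. i \<in> Basis \<Longrightarrow> f i \<in> borel_measurable borel"
    using int by (auto dest: borel_measurable_integrable)
  have I: "integrable (Pi\<^sub>M (Basis::'a set) (\<lambda>_. lborel)) (\<lambda>x. \<Prod>i\<in>Basis. f i (x i))"
    by (rule product_integrable_prod) (use int in auto)
  have L: "(LINT x|Pi\<^sub>M (Basis::'a set) (\<lambda>_. lborel). (\<Prod>i\<in>Basis. f i (x i))) = (\<Prod>i\<in>Basis. (LINT t|lborel. f i t))"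
    by (rule product_integral_prod) (use int in auto)
  have m: "(\<lambda>g. \<Sum>b\<in>Basis. g b *\<^sub>R b) \<in> Pi\<^sub>M (Basis::'a set) (\<lambda>_. lborel) \<rightarrow>\<^sub>M borel"
    by measurable
  have mf: "(\<lambda>x. \<Prod>i\<in>Basis. f i (x \<bullet> i)) \<in> borel_measurable (borel :: 'a measure)"
    by measurable
  show "integrable lborel (\<lambda>x. \<Prod>i\<in>Basis. f i (x \<bullet> i))"
    by (subst lborel_eq, subst integrable_distr_eq[OF m mf]) (use I in \<open>simp\<close>)
  show "(LINT x|lborel. (\<Prod>i\<in>Basis. f i (x \<bullet> i))) = (\<Prod>i\<in>Basis. (LINT t|lborel. f i t))"
    by (subst lborel_eq, subst integral_distr[OF m mf]) (use L in simp)
qed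

section \<open>Fourier inversion\<close>

lemma fourier_gaussian_real:
  fixes s :: real
  shows "integrable lborel (\<lambda>t. exp (- \<i> * complex_of_real (s * t)) * complex_of_real (exp (- t\<^sup>2 / 2)))"
    and "(LINT t|lborel. exp (- \<i> * complex_of_real (s * t)) * complex_of_real (exp (- t\<^sup>2 / 2)))
      = complex_of_real (sqrt (2 * pi) * exp (- s\<^sup>2 / 2))"
proof -
  have eq: "std_normal_density t *\<^sub>R iexp (- s * t)
     = complex_of_real (1 / sqrt (2 * pi)) *
        (exp (- \<i> * complex_of_real (s * t)) * complex_of_real (exp (- t\<^sup>2 / 2)))" for t
    by (simp add: std_normal_density_def scaleR_conv_of_real)
  have "integrable lborel (\<lambda>t. std_normal_density t *\<^sub>R iexp (- s * t))"
  proof (rule Bochner_Integration.integrable_bound)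
    show "integrable lborel std_normal_density" by simp
    show "AE t in lborel. norm (std_normal_density t *\<^sub>R iexp (- s * t)) \<le> norm (std_normal_density t)"
      by (rule AE_I2) (simp add: norm_exp_i_times)
  qed measurable
  then have "integrable lborel (\<lambda>t. complex_of_real (sqrt (2 * pi)) * (std_normal_density t *\<^sub>R iexp (- s * t)))"
    by (intro integrable_mult_right)
  moreover have "complex_of_real (sqrt (2 * pi)) * (std_normal_density t *\<^sub>R iexp (- s * t))
     = exp (- \<i> * complex_of_real (s * t)) * complex_of_real (exp (- t\<^sup>2 / 2))" for t
    unfolding eq by (simp add: mult.assoc[symmetric] of_real_mult[symmetric] real_sqrt_mult del: of_real_mult)
  ultimately show "integrable lborel (\<lambda>t. exp (- \<i> * complex_of_real (s * t)) * complex_of_real (exp (- t\<^sup>2 / 2)))"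
    by (simp only:)
  have "complex_of_real (exp (- s\<^sup>2 / 2)) = char std_normal_distribution (- s)"
    by (simp add: char_std_normal_distribution)
  also have "\<dots> = (LINT t|lborel. std_normal_density t *\<^sub>R iexp (- s * t))"
    unfolding char_def by (subst integral_density) (auto simp: normal_density_nonneg)
  also have "\<dots> = complex_of_real (1 / sqrt (2 * pi)) *
      (LINT t|lborel. exp (- \<i> * complex_of_real (s * t)) * complex_of_real (exp (- t\<^sup>2 / 2)))"
    unfolding eq by simp
  finally have "complex_of_real (sqrt (2 * pi)) * complex_of_real (exp (- s\<^sup>2 / 2)) = \<dots> * complex_of_real (sqrt (2 * pi))"
    by (simp add: mult.commute)
  then show "(LINT t|lborel. exp (- \<i> * complex_of_real (s * t)) * complex_of_real (exp (- t\<^sup>2 / 2)))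
      = complex_of_real (sqrt (2 * pi) * exp (- s\<^sup>2 / 2))"
    by (simp add: of_real_mult[symmetric] del: of_real_mult)
qed

text \<open>The Gaussian, normalized to be a multiple of its own Fourier transform.\<close>

definition gauss :: "'a::euclidean_space \<Rightarrow> real" where
  "gauss z = exp (- (z \<bullet> z) / 2)"

lemma gauss_nonneg: "0 \<le> gauss z" and gauss_le_1: "gauss z \<le> 1"
  by (simp_all add: gauss_def)

lemma gauss_measurable [measurable]: "gauss \<in> borel_measurable borel"
  unfolding gauss_def[abs_def] by measurable

lemma fourier_gauss:
  fixes w :: "'a::euclidean_space"
  shows "integrable lborel (\<lambda>z. exp (- \<i> * complex_of_real (w \<bullet> z)) * complex_of_real (gauss z))"
    and "(LINT z|lborel. exp (- \<i> * complex_of_real (w \<bullet> z)) * complex_of_real (gauss z))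
      = complex_of_real (sqrt (2 * pi) ^ DIM('a) * gauss w)"
proof -
  have g: "gauss z = (\<Prod>i\<in>Basis. exp (- (z \<bullet> i)\<^sup>2 / 2))" for z :: 'a
    unfolding gauss_def euclidean_inner[of z z]
    by (simp add: exp_sum[symmetric] sum_negf sum_divide_distrib power2_eq_square)
  have e: "exp (- \<i> * complex_of_real (w \<bullet> z)) = (\<Prod>i\<in>Basis. exp (- \<i> * complex_of_real ((w \<bullet> i) * (z \<bullet> i))))" for z
    unfolding euclidean_inner[of w z]
    by (simp add: exp_sum[symmetric] sum_negf sum_distrib_left)
  have eq: "exp (- \<i> * complex_of_real (w \<bullet> z)) * complex_of_real (gauss z)
    = (\<Prod>i\<in>Basis. exp (- \<i> * complex_of_real ((w \<bullet> i) * (z \<bullet> i))) * complex_of_real (exp (- (z \<bullet> i)\<^sup>2 / 2)))" for z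
    unfolding e g by (simp add: prod.distrib)
  show "integrable lborel (\<lambda>z. exp (- \<i> * complex_of_real (w \<bullet> z)) * complex_of_real (gauss z))"
    unfolding eq by (intro lborel_prod_integrable_integral(1) fourier_gaussian_real)
  show "(LINT z|lborel. exp (- \<i> * complex_of_real (w \<bullet> z)) * complex_of_real (gauss z))
      = complex_of_real (sqrt (2 * pi) ^ DIM('a) * gauss w)"
    unfolding eq
    by (simp only: lborel_prod_integrable_integral(2)[OF fourier_gaussian_real(1)] fourier_gaussian_real(2))
       (simp add: g prod.distrib del: of_real_exp)
qed

lemma integrable_gauss: "integrable lborel (\<lambda>z. complex_of_real (gauss (z::'a::euclidean_space)))"
  using fourier_gauss(1)[of 0] by simp

lemma integral_gauss:
  "(LINT z|lborel. complex_of_real (gauss (z::'a::euclidean_space))) = complex_of_real (sqrt (2 * pi) ^ DIM('a))"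
  using fourier_gauss(2)[of 0] by (simp add: gauss_def)

text \<open>
  The Fourier transform with the sign and the (missing) normalization of \<^const>\<open>partial_fourier\<close>. Where
  the integral diverges, its value is 0.
\<close>

definition fourier :: "('a::euclidean_space \<Rightarrow> complex) \<Rightarrow> 'a \<Rightarrow> complex" where
  "fourier g w = (LINT y|lborel. exp (- \<i> * complex_of_real (w \<bullet> y)) * g y)"

lemma norm_char [simp]: "cmod (exp (- (\<i> * complex_of_real t))) = 1"
  using norm_exp_i_times[of "- t"] by simp

lemma fourier_measurable [measurable]:
  assumes [measurable]: "g \<in> borel_measurable borel"
  shows "fourier g \<in> borel_measurable borel"
  unfolding fourier_def[abs_def] by measurable

lemma integrable_char_mult_iff:
  assumes [measurable]: "g \<in> borel_measurable borel"
  shows "integrable lborel (\<lambda>y. exp (- \<i> * complex_of_real (w \<bullet> y)) * g y) \<longleftrightarrow> integrable lborel g"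
  using assms by (simp add: integrable_iff_bounded norm_mult)

lemma norm_fourier_le:
  "cmod (fourier g w) \<le> (LINT y|lborel. cmod (g y))"
  unfolding fourier_def
  using integral_norm_bound[of lborel "\<lambda>y. exp (- \<i> * complex_of_real (w \<bullet> y)) * g y"]
  by (simp add: norm_mult)

text \<open>
  Transforming \<open>fourier b\<close> once more returns the reflection of \<open>b\<close> up to a constant. With a Gaussian
  factor of width \<open>1/s\<close> under the integral, \<open>b\<close> is replaced by its average against a Gaussian of
  width \<open>s\<close>.
\<close>

lemma gauss_fourier_inverse:
  fixes b :: "'a::euclidean_space \<Rightarrow> complex"
  assumes b: "integrable lborel b" and s: "s > 0"
  shows "(LINT w|lborel. exp (- \<i> * complex_of_real (w \<bullet> y)) * (fourier b w * complex_of_real (gauss (s *\<^sub>R w))))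
    = complex_of_real (sqrt (2 * pi) ^ DIM('a)) * (LINT z|lborel. b (s *\<^sub>R z - y) * complex_of_real (gauss z))"
proof -
  have [measurable]: "b \<in> borel_measurable borel" using b by (auto dest: borel_measurable_integrable)
  let ?f = "\<lambda>(w::'a) y'. exp (- \<i> * complex_of_real (w \<bullet> (y' + y))) * (complex_of_real (gauss (s *\<^sub>R w)) * b y')"
  let ?C = "complex_of_real (sqrt (2 * pi) ^ DIM('a))"
  have gs: "integrable lborel (\<lambda>w::'a. complex_of_real (gauss (s *\<^sub>R w)))"
    using lborel_integrable_affine[OF integrable_gauss, of s 0] s by simp
  have "integrable (lborel \<Otimes>\<^sub>M lborel) (case_prod ?f)"
    by (rule Bochner_Integration.integrable_bound[OF integrable_lborel_tensor[OF gs b]])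
       (auto simp: norm_mult)
  from lborel_pair.Fubini_integral[OF this]
  have F: "(LINT w|lborel. LINT y'|lborel. ?f w y') = (LINT y'|lborel. LINT w|lborel. ?f w y')" by simp
  have 1: "(LINT y'|lborel. ?f w y') =
      exp (- \<i> * complex_of_real (w \<bullet> y)) * (fourier b w * complex_of_real (gauss (s *\<^sub>R w)))" for w
  proof -
    have "(LINT y'|lborel. ?f w y') = (LINT y'|lborel.
        (exp (- \<i> * complex_of_real (w \<bullet> y)) * complex_of_real (gauss (s *\<^sub>R w))) *
          (exp (- \<i> * complex_of_real (w \<bullet> y')) * b y'))"
      by (intro Bochner_Integration.integral_cong refl)
         (simp add: inner_add_right mult_exp_exp algebra_simps)
    also have "\<dots> = (exp (- \<i> * complex_of_real (w \<bullet> y)) * complex_of_real (gauss (s *\<^sub>R w)))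
        * fourier b w"
      unfolding fourier_def by (rule integral_mult_right_zero)
    finally show ?thesis by (simp only: ac_simps)
  qed
  have 2: "(LINT w|lborel. ?f w y') = complex_of_real (1 / s ^ DIM('a)) * ?C
      * (b y' * complex_of_real (gauss ((1 / s) *\<^sub>R (y' + y))))" for y'
  proof -
    have "(LINT w|lborel. exp (- \<i> * complex_of_real (w \<bullet> (y' + y))) * complex_of_real (gauss (s *\<^sub>R w)))
      = complex_of_real (1 / s ^ DIM('a)) *
        (LINT w|lborel. exp (- \<i> * complex_of_real ((0 + (1 / s) *\<^sub>R w) \<bullet> (y' + y))) *
           complex_of_real (gauss (s *\<^sub>R (0 + (1 / s) *\<^sub>R w))))"
      using s by (subst lborel_integral_affine[of "1 / s" _ 0]) (auto simp: power_one_over)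
    also have "(LINT w|lborel. exp (- \<i> * complex_of_real ((0 + (1 / s) *\<^sub>R w) \<bullet> (y' + y))) *
           complex_of_real (gauss (s *\<^sub>R (0 + (1 / s) *\<^sub>R w))))
       = (LINT w|lborel. exp (- \<i> * complex_of_real (((1 / s) *\<^sub>R (y' + y)) \<bullet> w)) * complex_of_real (gauss w))"
      using s by (simp add: inner_commute)
    also have "\<dots> = ?C * complex_of_real (gauss ((1 / s) *\<^sub>R (y' + y)))"
      by (subst fourier_gauss(2)) simp
    finally have "(LINT w|lborel. exp (- \<i> * complex_of_real (w \<bullet> (y' + y))) * complex_of_real (gauss (s *\<^sub>R w))) * b y'
      = complex_of_real (1 / s ^ DIM('a)) * ?C * (b y' * complex_of_real (gauss ((1 / s) *\<^sub>R (y' + y))))"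
      by (simp only: ac_simps)
    then show ?thesis by (simp only: mult.assoc[symmetric] integral_mult_left_zero)
  qed
  have "(LINT y'|lborel. b y' * complex_of_real (gauss ((1 / s) *\<^sub>R (y' + y))))
    = complex_of_real (s ^ DIM('a)) * (LINT z|lborel. b (- y + s *\<^sub>R z) * complex_of_real (gauss ((1 / s) *\<^sub>R ((- y + s *\<^sub>R z) + y))))"
    using s by (subst lborel_integral_affine[of s _ "- y"]) auto
  also have "\<dots> = complex_of_real (s ^ DIM('a)) * (LINT z|lborel. b (s *\<^sub>R z - y) * complex_of_real (gauss z))"
    using s by simp
  finally show ?thesis using F s unfolding 1 2 by simp
qed

text \<open>
  This form of the inversion formula does not use the decay of \<open>fourier b\<close>: integrability of the
  product suffices to remove the Gaussian factor by dominated convergence.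
\<close>

lemma fourier_pairing:
  fixes g b :: "'a::euclidean_space \<Rightarrow> complex"
  assumes g: "integrable lborel g" and b: "b \<in> test_functions"
    and int: "integrable lborel (\<lambda>w. fourier g w * fourier b w)"
  shows "(LINT w|lborel. fourier g w * fourier b w)
    = complex_of_real ((2 * pi) ^ DIM('a)) * (LINT y|lborel. g y * b (- y))"
proof -
  have [measurable]: "g \<in> borel_measurable borel" using g by (auto dest: borel_measurable_integrable)
  have bm [measurable]: "b \<in> borel_measurable borel" using b by (rule measurable_test)
  have cb: "continuous_on UNIV b" using b by (rule continuous_test)
  have bi: "integrable lborel b"
    using integrable_continuous_test[OF continuous_on_const b, of 1] by simp
  obtain M where M: "M \<ge> 0" "\<And>y. cmod (b y) \<le> M"
    using b compact_support_bounded[OF cb] unfolding test_functions_def by blast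
  let ?C = "complex_of_real (sqrt (2 * pi) ^ DIM('a))"
  \<comment> \<open>Gaussian factors of growing width; \<open>J n\<close> is the matching average of \<open>b\<close> near \<open>- y\<close>.\<close>
  define s where "s n = 1 / real (Suc n)" for n
  have s0: "s n > 0" for n by (simp add: s_def)
  have slim: "s \<longlonglongrightarrow> 0" unfolding s_def[abs_def] by (rule LIMSEQ_Suc[OF lim_1_over_n])
  define J where "J n y = (LINT z|lborel. b (s n *\<^sub>R z - y) * complex_of_real (gauss z))" for n y
  have [measurable]: "J n \<in> borel_measurable borel" for n
    unfolding J_def[abs_def] by measurable
  have gb: "integrable lborel (\<lambda>z. M * gauss (z::'a))"
    using integrable_Re[OF integrable_gauss[where 'a = 'a]] by simp
  have J_bound: "cmod (J n y) \<le> (LINT z|lborel. M * gauss (z::'a))" for n y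
    unfolding J_def
  proof (rule integral_norm_bound[THEN order_trans], rule integral_mono')
    show "integrable lborel (\<lambda>z. M * gauss (z::'a))" by (rule gb)
  qed (use M in \<open>auto simp: norm_mult gauss_nonneg intro!: mult_right_mono\<close>)
  have J_lim: "(\<lambda>n. J n y) \<longlonglongrightarrow> b (- y) * ?C" for y
  proof -
    have "(\<lambda>n. J n y) \<longlonglongrightarrow> (LINT z|lborel. b (- y) * complex_of_real (gauss (z::'a)))"
      unfolding J_def
    proof (rule integral_dominated_convergence[where w = "\<lambda>z. M * gauss z"])
      show "AE z in lborel. (\<lambda>n. b (s n *\<^sub>R z - y) * complex_of_real (gauss z))
          \<longlonglongrightarrow> b (- y) * complex_of_real (gauss z)"
      proof (rule AE_I2)
        fix z :: 'a
        have "(\<lambda>n. s n *\<^sub>R z - y) \<longlonglongrightarrow> 0 *\<^sub>R z - y"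
          by (intro tendsto_intros slim)
        then have "(\<lambda>n. b (s n *\<^sub>R z - y)) \<longlonglongrightarrow> b (0 *\<^sub>R z - y)"
          using continuous_on_tendsto_compose[OF cb] by simp
        then show "(\<lambda>n. b (s n *\<^sub>R z - y) * complex_of_real (gauss z))
          \<longlonglongrightarrow> b (- y) * complex_of_real (gauss z)" by (auto intro: tendsto_mult)
      qed
      show "AE z in lborel. cmod (b (s n *\<^sub>R z - y) * complex_of_real (gauss z)) \<le> M * gauss z" for n
        using M by (intro AE_I2) (auto simp: norm_mult gauss_nonneg intro!: mult_right_mono)
    qed (use gb in auto)
    then show ?thesis by (simp only: integral_mult_right_zero integral_gauss)
  qed
  have step: "(LINT w|lborel. (fourier g w * fourier b w) * complex_of_real (gauss (s n *\<^sub>R w)))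
      = ?C * (LINT y|lborel. g y * J n y)" for n
  proof -
    let ?h = "\<lambda>w. fourier b w * complex_of_real (gauss (s n *\<^sub>R w))"
    let ?f = "\<lambda>(w::'a) y. exp (- \<i> * complex_of_real (w \<bullet> y)) * (?h w * g y)"
    have gs: "integrable lborel (\<lambda>w::'a. complex_of_real (gauss (s n *\<^sub>R w)))"
      using lborel_integrable_affine[OF integrable_gauss, of "s n" 0] s0[of n] by simp
    let ?B = "LINT y|lborel. cmod (b y)"
    have h: "integrable lborel ?h"
    proof (rule Bochner_Integration.integrable_bound)
      show "integrable lborel (\<lambda>w::'a. complex_of_real ?B * complex_of_real (gauss (s n *\<^sub>R w)))"
        by (intro integrable_mult_right gs)
      show "AE w in lborel. cmod (?h w) \<le> cmod (complex_of_real ?B * complex_of_real (gauss (s n *\<^sub>R w)))"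
        using norm_fourier_le[of b]
        by (intro AE_I2) (auto simp: norm_mult gauss_nonneg intro!: mult_right_mono abs_ge_self[THEN order_trans[rotated]])
    qed measurable
    have "integrable (lborel \<Otimes>\<^sub>M lborel) (case_prod ?f)"
      by (rule Bochner_Integration.integrable_bound[OF integrable_lborel_tensor[OF h g]])
         (auto simp: norm_mult)
    from lborel_pair.Fubini_integral[OF this]
    have F: "(LINT w|lborel. LINT y|lborel. ?f w y) = (LINT y|lborel. LINT w|lborel. ?f w y)" by simp
    have 1: "(LINT y|lborel. ?f w y) = (fourier g w * fourier b w) * complex_of_real (gauss (s n *\<^sub>R w))" for w
    proof -
      have "(LINT y|lborel. ?f w y) = (LINT y|lborel. ?h w * (exp (- \<i> * complex_of_real (w \<bullet> y)) * g y))"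
        by (simp add: ac_simps)
      also have "\<dots> = ?h w * fourier g w"
        unfolding fourier_def[of g] by (rule integral_mult_right_zero)
      finally show ?thesis by (simp only: ac_simps)
    qed
    have 2: "(LINT w|lborel. ?f w y) = ?C * (g y * J n y)" for y
    proof -
      have "(LINT w|lborel. ?f w y) = (LINT w|lborel. g y * (exp (- \<i> * complex_of_real (w \<bullet> y)) * ?h w))"
        by (simp add: ac_simps)
      also have "\<dots> = g y * (LINT w|lborel. exp (- \<i> * complex_of_real (w \<bullet> y)) * ?h w)"
        by (rule integral_mult_right_zero)
      finally show ?thesis
        unfolding gauss_fourier_inverse[OF bi s0] J_def by (simp only: ac_simps)
    qed
    show ?thesis using F unfolding 1 2 integral_mult_right_zero .
  qed
  have "(\<lambda>n. LINT w|lborel. (fourier g w * fourier b w) * complex_of_real (gauss (s n *\<^sub>R w)))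
     \<longlonglongrightarrow> (LINT w|lborel. (fourier g w * fourier b w) * complex_of_real (gauss (0 *\<^sub>R w)))"
  proof (rule integral_dominated_convergence[where w = "\<lambda>w. cmod (fourier g w * fourier b w)"])
    show "AE w in lborel. (\<lambda>n. (fourier g w * fourier b w) * complex_of_real (gauss (s n *\<^sub>R w)))
      \<longlonglongrightarrow> (fourier g w * fourier b w) * complex_of_real (gauss (0 *\<^sub>R w))"
      unfolding gauss_def by (intro AE_I2 tendsto_intros slim) auto
    show "AE w in lborel. cmod ((fourier g w * fourier b w) * complex_of_real (gauss (s n *\<^sub>R w)))
        \<le> cmod (fourier g w * fourier b w)" for n
      by (rule AE_I2, subst norm_mult, rule mult_right_le_one_le) (auto simp: gauss_nonneg gauss_le_1)
  qed (use int in auto)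
  moreover have "(\<lambda>n. ?C * (LINT y|lborel. g y * J n y)) \<longlonglongrightarrow> ?C * (LINT y|lborel. g y * (b (- y) * ?C))"
  proof (intro tendsto_mult tendsto_const integral_dominated_convergence[where w = "\<lambda>y. cmod (g y) * (LINT z|lborel. M * gauss (z::'a))"])
    show "AE y in lborel. (\<lambda>n. g y * J n y) \<longlonglongrightarrow> g y * (b (- y) * ?C)"
      by (intro AE_I2 tendsto_intros J_lim)
    show "AE y in lborel. cmod (g y * J n y) \<le> cmod (g y) * (LINT z|lborel. M * gauss (z::'a))" for n
      by (intro AE_I2) (auto simp only: norm_mult intro!: mult_left_mono J_bound norm_ge_zero)
  qed (use g in \<open>auto intro!: integrable_norm\<close>)
  ultimately have "(LINT w|lborel. (fourier g w * fourier b w) * complex_of_real (gauss (0 *\<^sub>R w)))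
      = ?C * (LINT y|lborel. g y * (b (- y) * ?C))"
    unfolding step by (rule LIMSEQ_unique)
  moreover have "?C * ?C = complex_of_real ((2 * pi) ^ DIM('a))"
    unfolding of_real_mult[symmetric] power_mult_distrib[symmetric] by simp
  moreover have "(LINT y|lborel. g y * (b (- y) * ?C)) = ?C * (LINT y|lborel. g y * b (- y))"
    by (simp add: mult.assoc[symmetric] del: of_real_power)
  ultimately show ?thesis by (simp add: gauss_def mult.assoc[symmetric] del: of_real_power)
qed


section \<open>The kernel in the coordinates of its Wigner function\<close>

text \<open>
  Midpoint and difference coordinates: \<open>wigner_coord h (x, y) = (X, Y)\<close> with \<open>x = (X + Y) / 2\<close> and
  \<open>y = (Y - X) / h\<close>. The map \<open>kernel_coord h\<close> below is its inverse for \<open>h \<noteq> 0\<close>.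
\<close>

definition wigner_coord :: "real \<Rightarrow> 'a::euclidean_space \<times> 'a \<Rightarrow> 'a \<times> 'a" where
  "wigner_coord h = (\<lambda>(x, y). (x - (h / 2) *\<^sub>R y, x + (h / 2) *\<^sub>R y))"

definition kernel_coord :: "real \<Rightarrow> 'a::euclidean_space \<times> 'a \<Rightarrow> 'a \<times> 'a" where
  "kernel_coord h = (\<lambda>(X, Y). ((1 / 2) *\<^sub>R (X + Y), (1 / h) *\<^sub>R (Y - X)))"

lemma kernel_wigner_coord:
  assumes "h \<noteq> 0"
  shows "kernel_coord h (wigner_coord h p) = p"
proof -
  have "(1 / 2) *\<^sub>R (x - (h / 2) *\<^sub>R y + (x + (h / 2) *\<^sub>R y)) = x" for x y :: 'a
    by (simp add: scaleR_2[symmetric])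
  moreover have "(x + (h / 2) *\<^sub>R y) - (x - (h / 2) *\<^sub>R y) = h *\<^sub>R y" for x y :: 'a
    by (simp add: scaleR_left_distrib[symmetric])
  ultimately show ?thesis using assms by (simp add: kernel_coord_def wigner_coord_def split: prod.split)
qed

lemma wigner_coord_measurable [measurable]: "wigner_coord h \<in> borel \<rightarrow>\<^sub>M borel"
  unfolding wigner_coord_def
  by (intro borel_measurable_continuous_onI) (auto simp: case_prod_unfold intro!: continuous_intros)

lemma kernel_coord_continuous: "continuous_on UNIV (kernel_coord h)"
  unfolding kernel_coord_def by (auto simp: case_prod_unfold intro!: continuous_intros)

lemma nn_integral_wigner_coord:
  fixes f :: "'a::euclidean_space \<times> 'a \<Rightarrow> ennreal"
  assumes f [measurable]: "f \<in> borel_measurable borel" and h: "h > 0"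
  shows "(\<integral>\<^sup>+p. f p \<partial>lborel) = ennreal (h ^ DIM('a)) * (\<integral>\<^sup>+p. f (wigner_coord h p) \<partial>lborel)"
proof -
  have fm [measurable]: "f \<in> borel_measurable (lborel \<Otimes>\<^sub>M lborel)"
    unfolding lborel_prod by simp
  have "(\<lambda>p. f (wigner_coord h p)) \<in> borel_measurable (lborel \<Otimes>\<^sub>M lborel)"
    unfolding lborel_prod by simp
  then have m1 [measurable]: "(\<lambda>(x, y). f (x - (h / 2) *\<^sub>R y, x + (h / 2) *\<^sub>R y)) \<in> borel_measurable (lborel \<Otimes>\<^sub>M lborel)"
    by (simp add: wigner_coord_def case_prod_unfold)
  have m2 [measurable]: "(\<lambda>(x, y). f (x, x + h *\<^sub>R y)) \<in> borel_measurable (lborel \<Otimes>\<^sub>M lborel)"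
  proof -
    have "(\<lambda>(x, y). (x, x + h *\<^sub>R y)) \<in> (borel :: ('a \<times> 'a) measure) \<rightarrow>\<^sub>M borel"
      by (intro borel_measurable_continuous_onI) (auto simp: case_prod_unfold intro!: continuous_intros)
    then have "(\<lambda>p. f ((\<lambda>(x, y). (x, x + h *\<^sub>R y)) p)) \<in> borel_measurable borel"
      by (rule measurable_compose) (rule f)
    then show ?thesis unfolding lborel_prod by (simp add: case_prod_unfold)
  qed
  have sec [measurable]: "(\<lambda>y. f (x, y)) \<in> borel_measurable borel" for x
    using measurable_Pair2[OF fm, of x] by simp
  have sec' [measurable]: "(\<lambda>x. f (x, x + h *\<^sub>R y)) \<in> borel_measurable borel" for y
    using measurable_Pair1[OF m2, of y] by simp
  have "(\<integral>\<^sup>+p. f (wigner_coord h p) \<partial>lborel)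
      = (\<integral>\<^sup>+x. \<integral>\<^sup>+y. f (x - (h / 2) *\<^sub>R y, x + (h / 2) *\<^sub>R y) \<partial>lborel \<partial>lborel)"
    unfolding lborel_prod[symmetric] using lborel.nn_integral_fst[OF m1]
    by (simp add: wigner_coord_def case_prod_unfold)
  also have "\<dots> = (\<integral>\<^sup>+y. \<integral>\<^sup>+x. f (x - (h / 2) *\<^sub>R y, x + (h / 2) *\<^sub>R y) \<partial>lborel \<partial>lborel)"
    using lborel_pair.Fubini'[OF m1] by simp
  also have "\<dots> = (\<integral>\<^sup>+y. \<integral>\<^sup>+x. f (x, x + h *\<^sub>R y) \<partial>lborel \<partial>lborel)"
  proof (rule nn_integral_cong)
    fix y :: 'a
    have s: "x - (h / 2) *\<^sub>R y + h *\<^sub>R y = x + (h / 2) *\<^sub>R y" for x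
    proof -
      have "h *\<^sub>R y = (h / 2) *\<^sub>R y + (h / 2) *\<^sub>R y" by (simp add: scaleR_left_distrib[symmetric])
      then show ?thesis by simp
    qed
    show "(\<integral>\<^sup>+x. f (x - (h / 2) *\<^sub>R y, x + (h / 2) *\<^sub>R y) \<partial>lborel) = (\<integral>\<^sup>+x. f (x, x + h *\<^sub>R y) \<partial>lborel)"
      using lborel_nn_integral_affine[OF sec', of 1 y "- ((h / 2) *\<^sub>R y)"] by (simp add: s)
  qed
  also have "\<dots> = (\<integral>\<^sup>+x. \<integral>\<^sup>+y. f (x, x + h *\<^sub>R y) \<partial>lborel \<partial>lborel)"
    using lborel_pair.Fubini'[OF m2] by simp
  finally have "ennreal (h ^ DIM('a)) * (\<integral>\<^sup>+p. f (wigner_coord h p) \<partial>lborel)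
     = (\<integral>\<^sup>+x. ennreal (h ^ DIM('a)) * \<integral>\<^sup>+y. f (x, x + h *\<^sub>R y) \<partial>lborel \<partial>lborel)"
    by (simp add: nn_integral_cmult)
  also have "\<dots> = (\<integral>\<^sup>+x. \<integral>\<^sup>+y. f (x, y) \<partial>lborel \<partial>lborel)"
    using lborel_nn_integral_affine[OF sec, of h] h by simp
  also have "\<dots> = (\<integral>\<^sup>+p. f p \<partial>lborel)"
    unfolding lborel_prod[symmetric] using lborel.nn_integral_fst[OF fm] by simp
  finally show ?thesis ..
qed

lemma L2_wigner_coord:
  assumes "f \<in> L2" "h > 0"
  shows "(\<lambda>p. f (wigner_coord h p)) \<in> L2"
proof -
  have f [measurable]: "f \<in> borel_measurable borel" and i: "integrable lborel (\<lambda>x. (cmod (f x))\<^sup>2)"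
    using assms(1) by (auto simp: L2_def)
  have "(\<integral>\<^sup>+x. ennreal ((cmod (f x))\<^sup>2) \<partial>lborel) < \<infinity>"
    using i by (simp add: integrable_iff_bounded)
  moreover have "(\<lambda>x. ennreal ((cmod (f x))\<^sup>2)) \<in> borel_measurable borel" by measurable
  ultimately show ?thesis
    using assms(2) nn_integral_wigner_coord[of "\<lambda>x. ennreal ((cmod (f x))\<^sup>2)" h]
    by (auto simp: L2_def integrable_iff_bounded ennreal_mult_less_top)
qed

lemma AE_wigner_coord:
  assumes "h > 0" and [measurable]: "Measurable.pred borel Q"
    and "AE p in lborel. Q (wigner_coord h p)"
  shows "AE p in lborel. Q p"
proof -
  have "(\<integral>\<^sup>+p. indicator {p. \<not> Q p} (wigner_coord h p) \<partial>lborel) = 0"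
    by (subst nn_integral_0_iff_AE) (use assms(3) in \<open>auto elim!: eventually_mono\<close>)
  then have "(\<integral>\<^sup>+p. indicator {p. \<not> Q p} p \<partial>lborel) = 0"
    by (subst nn_integral_wigner_coord[OF _ assms(1)]) auto
  then show ?thesis by (subst (asm) nn_integral_0_iff_AE) (auto elim!: eventually_mono simp: indicator_def split: if_splits)
qed

lemma integrable_L2_mult:
  assumes "f \<in> L2" "g \<in> L2"
  shows "integrable lborel (\<lambda>x. f x * g x)"
proof (rule Bochner_Integration.integrable_bound)
  show "integrable lborel (\<lambda>x. (cmod (f x))\<^sup>2 + (cmod (g x))\<^sup>2)"
    using assms by (simp add: L2_def)
  show "AE x in lborel. norm (f x * g x) \<le> norm ((cmod (f x))\<^sup>2 + (cmod (g x))\<^sup>2)"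
  proof (rule AE_I2)
    fix x
    have "2 * (cmod (f x) * cmod (g x)) \<le> (cmod (f x))\<^sup>2 + (cmod (g x))\<^sup>2"
      using sum_squares_bound[of "cmod (f x)" "cmod (g x)"] by simp
    moreover have "0 \<le> cmod (f x) * cmod (g x)" by simp
    ultimately show "norm (f x * g x) \<le> norm ((cmod (f x))\<^sup>2 + (cmod (g x))\<^sup>2)"
      by (simp only: norm_mult real_norm_def)
  qed
  have [measurable]: "f \<in> borel_measurable borel" "g \<in> borel_measurable borel"
    using assms by (auto simp: L2_def)
  show "(\<lambda>x. f x * g x) \<in> borel_measurable lborel" by measurable
qed

lemma integrable_complex_mult_iff:
  fixes f :: "'a \<Rightarrow> complex"
  assumes "c \<noteq> 0"
  shows "integrable M (\<lambda>x. c * f x) \<longleftrightarrow> integrable M f"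
proof
  assume "integrable M (\<lambda>x. c * f x)"
  then show "integrable M f"
    using integrable_mult_right[of "inverse c" M "\<lambda>x. c * f x"] assms
    by (simp add: mult.assoc[symmetric])
qed auto

text \<open>
  The Wigner transform is a Fourier transform in \<open>y\<close> of the kernel in these coordinates, so its
  partial Fourier transform gives the kernel back. Where the Wigner integral diverges, it has the
  default value 0, and so has its Fourier transform. Since the latter is represented by a function
  without zeros, that can only happen on a null set.
  Integrability of almost all sections, a consequence of the trace-class property, is thus obtained
  without a spectral decomposition.
\<close>

lemma partial_fourier_wigner:
  fixes r F :: "(real^'n) \<times> (real^'n) \<Rightarrow> complex"
  assumes h: "h > 0" and r: "r \<in> L2"
    and F: "is_partial_fourier (wigner h r) F" and nz: "\<And>p. F p \<noteq> 0"
  shows "AE p in lborel. F p = r (wigner_coord h p)"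
proof -
  have rm [measurable]: "r \<in> borel_measurable borel" using r by (simp add: L2_def)
  define g where "g x y = r (x + (h / 2) *\<^sub>R y, x - (h / 2) *\<^sub>R y)" for x y
  have gr: "g x (- y) = r (wigner_coord h (x, y))" for x y by (simp add: g_def wigner_coord_def)
  have gm [measurable]: "(\<lambda>(x, y). g x y) \<in> borel_measurable (lborel \<Otimes>\<^sub>M lborel)"
  proof -
    have "(\<lambda>(x, y). (x + (h / 2) *\<^sub>R y, x - (h / 2) *\<^sub>R y)) \<in> (borel :: ((real^'n) \<times> (real^'n)) measure) \<rightarrow>\<^sub>M borel"
      by (intro borel_measurable_continuous_onI) (auto simp: case_prod_unfold intro!: continuous_intros)
    then have "(\<lambda>p. r ((\<lambda>(x, y). (x + (h / 2) *\<^sub>R y, x - (h / 2) *\<^sub>R y)) p)) \<in> borel_measurable borel"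
      by (rule measurable_compose) (rule rm)
    then show ?thesis unfolding lborel_prod by (simp add: case_prod_unfold g_def)
  qed
  have gx [measurable]: "g x \<in> borel_measurable borel" for x
    using measurable_Pair2[OF gm, of x] by simp
  define S where "S = {x. integrable lborel (g x)}"
  have Sm [measurable]: "S \<in> sets borel"
  proof -
    have "S = {x. (\<integral>\<^sup>+y. ennreal (cmod (g x y)) \<partial>lborel) < \<infinity>}"
      by (auto simp: S_def integrable_iff_bounded)
    also have "\<dots> \<in> sets borel"
      using lborel.borel_measurable_nn_integral[of "\<lambda>x y. ennreal (cmod (g x y))" borel] gm by measurable
    finally show ?thesis .
  qed
  let ?c = "1 / (2 * complex_of_real pi) ^ CARD('n)"
  have W: "wigner h r (x, w) = ?c * fourier (g x) w" for x w
    by (simp add: wigner_def fourier_def g_def)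
  have W0: "wigner h r (x, w) = 0" if "x \<notin> S" for x w
    using that integrable_char_mult_iff[OF gx, of w x]
    unfolding W fourier_def S_def by (subst not_integrable_integral_eq) auto
  \<comment> \<open>What the transform returns: the kernel, cut off where the Wigner integral diverges\<close>
  define q where "q p = indicator S (fst p) * r (wigner_coord h p)" for p
  have qm [measurable]: "q \<in> borel_measurable borel"
  proof -
    have [measurable]: "(fst :: (real^'n) \<times> (real^'n) \<Rightarrow> real^'n) \<in> borel \<rightarrow>\<^sub>M borel"
      by (intro borel_measurable_continuous_onI continuous_on_fst continuous_on_id)
    have [measurable]: "(\<lambda>p. r (wigner_coord h p)) \<in> borel_measurable borel"
      by (rule measurable_compose[OF wigner_coord_measurable rm])
    show ?thesis unfolding q_def[abs_def] by measurable
  qed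
  have qL: "q \<in> L2"
  proof -
    have "integrable lborel (\<lambda>p. (cmod (r (wigner_coord h p)))\<^sup>2)"
      using L2_wigner_coord[OF r h] by (simp add: L2_def)
    then have "integrable lborel (\<lambda>p. (cmod (q p))\<^sup>2)"
    proof (rule Bochner_Integration.integrable_bound)
      show "(\<lambda>p. (cmod (q p))\<^sup>2) \<in> borel_measurable lborel" by measurable
      show "AE p in lborel. norm ((cmod (q p))\<^sup>2) \<le> norm ((cmod (r (wigner_coord h p)))\<^sup>2)"
        by (rule AE_I2) (simp add: q_def indicator_def)
    qed
    then show ?thesis by (simp add: L2_def)
  qed
  have "AE p in lborel. F p - q p = 0"
  proof (rule AE_zero_if_tensor_tested_zero)
    fix \<alpha> \<beta> :: "real^'n \<Rightarrow> complex" assume \<alpha>: "\<alpha> \<in> test_functions" and \<beta>: "\<beta> \<in> test_functions"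
    define \<phi> where "\<phi> = (\<lambda>(x, y). \<alpha> x * \<beta> y)"
    have \<phi>: "\<phi> \<in> test_functions" unfolding \<phi>_def using \<alpha> \<beta> by (rule test_tensor)
    have \<phi>': "\<alpha> (fst p) * \<beta> (snd p) = \<phi> p" for p by (simp add: \<phi>_def case_prod_unfold)
    have pf: "partial_fourier \<phi> (x, w) = \<alpha> x * fourier \<beta> w" for x w
    proof -
      have "partial_fourier \<phi> (x, w) = (LINT y|lborel. \<alpha> x * (exp (- \<i> * complex_of_real (w \<bullet> y)) * \<beta> y))"
        by (simp add: partial_fourier_def \<phi>_def ac_simps)
      also have "\<dots> = \<alpha> x * fourier \<beta> w" unfolding fourier_def by (rule integral_mult_right_zero)
      finally show ?thesis .
    qed
    have iW: "integrable lborel (\<lambda>p. wigner h r p * partial_fourier \<phi> p)"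
      and iF: "integrable lborel (\<lambda>p. F p * \<phi> p)"
      and eq: "(LINT p|lborel. F p * \<phi> p) = (LINT p|lborel. wigner h r p * partial_fourier \<phi> p)"
      using F \<phi> by (auto simp: is_partial_fourier_def distr_eq_def distr_of_def)
    have iq: "integrable lborel (\<lambda>p. q p * \<phi> p)"
      by (rule integrable_L2_mult[OF qL test_in_L2[OF \<phi>]])
    have "AE x in lborel. (LINT w|lborel. wigner h r (x, w) * partial_fourier \<phi> (x, w))
        = (LINT y|lborel. q (x, y) * \<phi> (x, y))"
      using integrable_lborel_prodD(1)[OF iW]
    proof eventually_elim
      case (elim x)
      show ?case
      proof (cases "\<alpha> x = 0 \<or> x \<notin> S")
        case True
        then show ?thesis by (auto simp: pf \<phi>'[symmetric] W0 q_def)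
      next
        case False
        have c: "?c * \<alpha> x \<noteq> 0" using False by simp
        have e: "wigner h r (x, w) * partial_fourier \<phi> (x, w) = (?c * \<alpha> x) * (fourier (g x) w * fourier \<beta> w)" for w
          by (simp add: W pf)
        have i: "integrable lborel (\<lambda>w. fourier (g x) w * fourier \<beta> w)"
          using elim unfolding e integrable_complex_mult_iff[OF c] .
        have gi: "integrable lborel (g x)" using False by (simp add: S_def)
        have "(LINT y|lborel. g x y * \<beta> (- y)) = (LINT y|lborel. g x (- y) * \<beta> y)"
          using lborel_integral_affine[of "- 1" "\<lambda>y. g x y * \<beta> (- y)" 0] measurable_test[OF \<beta>] by simp
        then have "(LINT w|lborel. fourier (g x) w * fourier \<beta> w)
          = complex_of_real ((2 * pi) ^ CARD('n)) * (LINT y|lborel. g x (- y) * \<beta> y)"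
          using fourier_pairing[OF gi \<beta> i] by simp
        then have "(LINT w|lborel. wigner h r (x, w) * partial_fourier \<phi> (x, w))
          = \<alpha> x * (LINT y|lborel. g x (- y) * \<beta> y)"
          unfolding e integral_mult_right_zero by (simp add: power_mult_distrib)
        also have "\<dots> = (LINT y|lborel. \<alpha> x * (g x (- y) * \<beta> y))" by (rule integral_mult_right_zero[symmetric])
        also have "\<dots> = (LINT y|lborel. q (x, y) * \<phi> (x, y))"
          using False by (simp add: gr q_def \<phi>'[symmetric] ac_simps)
        finally show ?thesis .
      qed
    qed
    then have "(LINT x|lborel. LINT w|lborel. wigner h r (x, w) * partial_fourier \<phi> (x, w))
        = (LINT x|lborel. LINT y|lborel. q (x, y) * \<phi> (x, y))"
      by (intro integral_cong_AE borel_measurable_integrable integrable_lborel_prodD(2)[OF iW]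
          integrable_lborel_prodD(2)[OF iq])
    then have "(LINT p|lborel. F p * \<phi> p) = (LINT p|lborel. q p * \<phi> p)"
      using eq integrable_lborel_prodD(3)[OF iW] integrable_lborel_prodD(3)[OF iq] by simp
    then show "(LINT p|lborel. (F p - q p) * (\<alpha> (fst p) * \<beta> (snd p))) = 0"
      unfolding \<phi>' using iF iq by (simp add: algebra_simps)
    show "integrable lborel (\<lambda>p. (F p - q p) * (\<alpha> (fst p) * \<beta> (snd p)))"
      unfolding \<phi>' using iF iq by (simp add: algebra_simps)
  qed
  then show ?thesis
  proof eventually_elim
    case (elim p)
    then show ?case using nz[of p] by (auto simp: q_def indicator_def split: if_splits)
  qed
qed

lemma kernel_AE_eq:
  fixes r F :: "(real^'n) \<times> (real^'n) \<Rightarrow> complex"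
  assumes h: "h > 0" and r: "r \<in> L2"
    and F: "is_partial_fourier (wigner h r) F" and nz: "\<And>p. F p \<noteq> 0" and c: "continuous_on UNIV F"
  shows "AE p in lborel. r p = F (kernel_coord h p)"
proof (rule AE_wigner_coord[OF h])
  have [measurable]: "r \<in> borel_measurable borel" using r by (simp add: L2_def)
  have "continuous_on UNIV (\<lambda>p. F (kernel_coord h p))"
    by (rule continuous_on_compose2[OF c kernel_coord_continuous]) simp
  then have [measurable]: "(\<lambda>p. F (kernel_coord h p)) \<in> borel_measurable borel"
    by (rule borel_measurable_continuous_onI)
  show "Measurable.pred borel (\<lambda>p. r p = F (kernel_coord h p))" by measurable
  show "AE p in lborel. r (wigner_coord h p) = F (kernel_coord h (wigner_coord h p))"
    using partial_fourier_wigner[OF h r F nz] h by (auto simp: kernel_wigner_coord elim!: eventually_mono)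
qed


section \<open>Translation invariance and distributional derivatives\<close>

lemma has_vector_derivative_line:
  assumes "f differentiable (at (p + s *\<^sub>R v))"
  shows "((\<lambda>s. f (p + s *\<^sub>R v)) has_vector_derivative dir_deriv v f (p + s *\<^sub>R v)) (at s)"
proof -
  have "((\<lambda>s. p + s *\<^sub>R v) has_derivative (\<lambda>h. h *\<^sub>R v)) (at s)"
    by (auto intro!: derivative_eq_intros)
  from has_derivative_compose[OF this has_derivative_dir_deriv[OF assms]]
  have "((\<lambda>s. f (p + s *\<^sub>R v)) has_derivative (\<lambda>h. dir_deriv (h *\<^sub>R v) f (p + s *\<^sub>R v))) (at s)" .
  moreover have "dir_deriv (h *\<^sub>R v) f (p + s *\<^sub>R v) = h *\<^sub>R dir_deriv v f (p + s *\<^sub>R v)" for h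
    by (rule linear_scale[OF has_derivative_linear[OF has_derivative_dir_deriv[OF assms]]])
  ultimately show ?thesis by (simp add: has_vector_derivative_def)
qed

lemma vector_derivative_quotient:
  fixes f :: "real \<Rightarrow> complex"
  assumes "(f has_vector_derivative D) (at 0)"
  shows "((\<lambda>s. (f s - f 0) / complex_of_real s) \<longlongrightarrow> D) (at 0)"
  using assms unfolding has_vector_derivative_complex_iff DERIV_def tendsto_complex_iff
  by simp

lemma dir_deriv_linear:
  assumes "f differentiable (at p)"
  shows "dir_deriv (a *\<^sub>R v + b *\<^sub>R w) f p = complex_of_real a * dir_deriv v f p + complex_of_real b * dir_deriv w f p"
proof -
  have lin: "linear (\<lambda>v. dir_deriv v f p)"
    by (rule has_derivative_linear[OF has_derivative_dir_deriv[OF assms]])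
  show ?thesis
    by (simp add: linear_add[OF lin] linear_scale[OF lin] scaleR_conv_of_real)
qed

text \<open>Differentiation under the integral sign, along a translation of the test function.\<close>

lemma translation_derivative:
  fixes g :: "'a::euclidean_space \<Rightarrow> complex"
  assumes g: "continuous_on UNIV g" and \<phi>: "\<phi> \<in> test_functions"
  shows "((\<lambda>t. ((LINT p|lborel. g p * \<phi> (p + t *\<^sub>R v)) - (LINT p|lborel. g p * \<phi> p)) / complex_of_real t)
    \<longlongrightarrow> (LINT p|lborel. g p * dir_deriv v \<phi> p)) (at 0)"
  unfolding tendsto_at_iff_sequentially
proof (intro allI impI)
  fix t :: "nat \<Rightarrow> real"
  assume t0: "\<forall>i. t i \<in> UNIV - {0}" and tlim: "t \<longlonglongrightarrow> 0"
  from \<phi> obtain K where K: "compact K" "\<And>p. p \<notin> K \<Longrightarrow> \<phi> p = 0" by (auto simp: test_functions_def)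
  from test_dir_deriv[OF \<phi>, of v] obtain K' where K': "compact K'" "\<And>p. p \<notin> K' \<Longrightarrow> dir_deriv v \<phi> p = 0"
    by (auto simp: test_functions_def)
  obtain M where M: "M \<ge> 0" "\<And>p. cmod (dir_deriv v \<phi> p) \<le> M"
    using compact_support_bounded[OF continuous_test[OF test_dir_deriv[OF \<phi>]] K'] by blast
  obtain R where R: "\<And>p. p \<in> K \<Longrightarrow> norm p \<le> R"
    using compact_imp_bounded[OF K(1)] by (auto simp: bounded_iff)
  obtain B where B: "\<And>i. \<bar>t i\<bar> \<le> B"
    using convergent_imp_Bseq[of t] tlim by (auto simp: convergent_def Bseq_def)
  let ?D = "cball 0 (R + B * norm v) :: 'a set"
  let ?q = "\<lambda>i p. (\<phi> (p + t i *\<^sub>R v) - \<phi> p) / complex_of_real (t i)"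
  have lip: "cmod (\<phi> (p + s *\<^sub>R v) - \<phi> p) \<le> M * \<bar>s\<bar>" for p s
  proof -
    have "norm (\<phi> (p + s *\<^sub>R v) - \<phi> (p + 0 *\<^sub>R v)) \<le> M * norm (s - 0)"
    proof (rule differentiable_bound[where S = UNIV and f = "\<lambda>s. \<phi> (p + s *\<^sub>R v)"])
      fix x :: real
      show "((\<lambda>s. \<phi> (p + s *\<^sub>R v)) has_derivative (\<lambda>h. h *\<^sub>R dir_deriv v \<phi> (p + x *\<^sub>R v))) (at x within UNIV)"
        using has_vector_derivative_line[OF differentiable_test[OF \<phi>]]
        by (simp add: has_vector_derivative_def)
      show "onorm (\<lambda>h. h *\<^sub>R dir_deriv v \<phi> (p + x *\<^sub>R v)) \<le> M"
      proof (rule onorm_le)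
        fix h :: real
        have "\<bar>h\<bar> * cmod (dir_deriv v \<phi> (p + x *\<^sub>R v)) \<le> \<bar>h\<bar> * M"
          by (rule mult_left_mono[OF M(2)]) simp
        then show "norm (h *\<^sub>R dir_deriv v \<phi> (p + x *\<^sub>R v)) \<le> M * norm h"
          by (simp add: mult.commute)
      qed
    qed auto
    then show ?thesis by simp
  qed
  \<comment> \<open>All difference quotients along the bounded sequence live on one ball, where the mean value
    inequality bounds them.\<close>
  have quot: "cmod (?q i p) \<le> M * indicator ?D p" for i p
  proof (cases "p \<in> ?D")
    case True
    have "cmod (?q i p) = cmod (\<phi> (p + t i *\<^sub>R v) - \<phi> p) / \<bar>t i\<bar>" by (simp add: norm_divide)
    also have "\<dots> \<le> M * \<bar>t i\<bar> / \<bar>t i\<bar>" by (rule divide_right_mono[OF lip]) simp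
    also have "\<dots> = M" using t0 by simp
    finally show ?thesis using True by simp
  next
    case False
    then have n: "norm p > R + B * norm v" by simp
    have "0 \<le> B" using B[of 0] by linarith
    then have "p \<notin> K" using R[of p] n mult_nonneg_nonneg[of B "norm v"] by fastforce
    moreover have "p + t i *\<^sub>R v \<notin> K"
    proof
      assume "p + t i *\<^sub>R v \<in> K"
      then have "norm (p + t i *\<^sub>R v) \<le> R" by (rule R)
      moreover have "norm (t i *\<^sub>R v) \<le> B * norm v" using B[of i] by (simp add: mult_right_mono)
      moreover have "norm p \<le> norm (p + t i *\<^sub>R v) + norm (t i *\<^sub>R v)"
        using norm_triangle_ineq4[of "p + t i *\<^sub>R v" "t i *\<^sub>R v"] by simp
      ultimately show False using n by linarith
    qed
    ultimately show ?thesis using False K(2) by simp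
  qed
  have int: "integrable lborel (\<lambda>p. g p * \<phi> (p + c))" for c
    by (intro integrable_continuous_test[OF g] test_translate \<phi>)
  have "(\<lambda>i. LINT p|lborel. g p * ?q i p) \<longlonglongrightarrow> (LINT p|lborel. g p * dir_deriv v \<phi> p)"
  proof (rule integral_dominated_convergence[where w = "\<lambda>p. M * (indicator ?D p *\<^sub>R cmod (g p))"])
    have "set_integrable lborel ?D (\<lambda>p. cmod (g p))"
      unfolding set_integrable_def
      by (rule borel_integrable_compact)
        (auto intro!: continuous_on_norm continuous_on_subset[OF g])
    then show "integrable lborel (\<lambda>p. M * (indicator ?D p *\<^sub>R cmod (g p)))"
      unfolding set_integrable_def by (intro integrable_mult_right)
    show "(\<lambda>p. g p * dir_deriv v \<phi> p) \<in> borel_measurable lborel"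
      by (rule borel_measurable_integrable[OF integrable_continuous_test[OF g test_dir_deriv[OF \<phi>]]])
    show "(\<lambda>p. g p * ?q i p) \<in> borel_measurable lborel" for i
    proof -
      have "(\<lambda>p. g p * \<phi> (p + t i *\<^sub>R v) - g p * \<phi> (p + 0)) \<in> borel_measurable lborel"
        by (intro borel_measurable_diff borel_measurable_integrable int)
      then have "(\<lambda>p. (g p * \<phi> (p + t i *\<^sub>R v) - g p * \<phi> (p + 0)) / complex_of_real (t i)) \<in> borel_measurable lborel"
        by (rule borel_measurable_divide) simp
      then show ?thesis by (simp add: algebra_simps)
    qed
    show "AE p in lborel. (\<lambda>i. g p * ?q i p) \<longlonglongrightarrow> g p * dir_deriv v \<phi> p"
    proof (intro AE_I2 tendsto_mult tendsto_const)
      fix p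
      have "((\<lambda>s. \<phi> (p + s *\<^sub>R v)) has_vector_derivative dir_deriv v \<phi> p) (at 0)"
        using has_vector_derivative_line[where p = p and s = 0 and v = v, OF differentiable_test[OF \<phi>]] by simp
      from vector_derivative_quotient[OF this]
      have "((\<lambda>s. (\<phi> (p + s *\<^sub>R v) - \<phi> p) / complex_of_real s) \<longlongrightarrow> dir_deriv v \<phi> p) (at 0)"
        by simp
      then show "(\<lambda>i. ?q i p) \<longlonglongrightarrow> dir_deriv v \<phi> p"
        using t0 tlim unfolding tendsto_at_iff_sequentially by (auto simp: o_def)
    qed
    show "AE p in lborel. norm (g p * ?q i p) \<le> M * (indicator ?D p *\<^sub>R cmod (g p))" for i
    proof (rule AE_I2)
      fix p
      have "cmod (g p) * cmod (?q i p) \<le> cmod (g p) * (M * indicator ?D p)"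
        by (rule mult_left_mono[OF quot]) simp
      then show "norm (g p * ?q i p) \<le> M * (indicator ?D p *\<^sub>R cmod (g p))"
        by (simp only: norm_mult real_scaleR_def ac_simps)
    qed
  qed
  moreover have "(LINT p|lborel. g p * ?q i p)
      = ((LINT p|lborel. g p * \<phi> (p + t i *\<^sub>R v)) - (LINT p|lborel. g p * \<phi> p)) / complex_of_real (t i)" for i
  proof -
    have "(LINT p|lborel. g p * ?q i p)
        = (LINT p|lborel. (g p * \<phi> (p + t i *\<^sub>R v) - g p * \<phi> p) / complex_of_real (t i))"
      by (simp add: algebra_simps diff_divide_distrib)
    also have "\<dots> = (LINT p|lborel. g p * \<phi> (p + t i *\<^sub>R v) - g p * \<phi> p) / complex_of_real (t i)"
      by (rule integral_divide_zero)
    finally show ?thesis using int[of "t i *\<^sub>R v"] int[of 0] by simp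
  qed
  ultimately show "((\<lambda>t. ((LINT p|lborel. g p * \<phi> (p + t *\<^sub>R v)) - (LINT p|lborel. g p * \<phi> p)) / complex_of_real t)
      \<circ> t) \<longlonglongrightarrow> (LINT p|lborel. g p * dir_deriv v \<phi> p)"
    by (simp only: o_def)
qed

lemma integral_translate_test:
  fixes g :: "'a::euclidean_space \<Rightarrow> complex"
  assumes g: "continuous_on UNIV g" and \<phi>: "\<phi> \<in> test_functions"
  shows "(LINT p|lborel. g p * \<phi> (p + c)) = (LINT p|lborel. g (p - c) * \<phi> p)"
proof -
  have "(\<lambda>p. g p * \<phi> (p + c)) \<in> borel_measurable borel"
    using borel_measurable_integrable[OF integrable_continuous_test[OF g test_translate[OF \<phi>]]] by simp
  from lborel_integral_affine[OF _ this, of 1 "- c"] show ?thesis by simp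
qed

text \<open>
  The distributional derivative of a continuous function in a direction vanishes if and only if the
  function is constant along that direction.
\<close>

lemma distr_deriv_zero_iff_invariant:
  fixes g :: "'a::euclidean_space \<Rightarrow> complex"
  assumes g: "continuous_on UNIV g"
  shows "(\<forall>\<phi>\<in>test_functions. (LINT p|lborel. g p * dir_deriv v \<phi> p) = 0)
    \<longleftrightarrow> (\<forall>p t. g (p + t *\<^sub>R v) = g p)"
proof
  assume inv: "\<forall>p t. g (p + t *\<^sub>R v) = g p"
  show "\<forall>\<phi>\<in>test_functions. (LINT p|lborel. g p * dir_deriv v \<phi> p) = 0"
  proof
    fix \<phi> :: "'a \<Rightarrow> complex" assume \<phi>: "\<phi> \<in> test_functions"
    have "(LINT p|lborel. g p * \<phi> (p + t *\<^sub>R v)) = (LINT p|lborel. g p * \<phi> p)" for t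
    proof -
      have "g (p - t *\<^sub>R v) = g p" for p using inv[rule_format, of p "- t"] by simp
      then show ?thesis by (simp add: integral_translate_test[OF g \<phi>])
    qed
    then have "((\<lambda>t :: real. 0) \<longlongrightarrow> (LINT p|lborel. g p * dir_deriv v \<phi> p)) (at 0)"
      using translation_derivative[OF g \<phi>, of v] by simp
    then show "(LINT p|lborel. g p * dir_deriv v \<phi> p) = 0"
      by (rule LIM_unique[OF _ tendsto_const])
  qed
next
  assume zero: "\<forall>\<phi>\<in>test_functions. (LINT p|lborel. g p * dir_deriv v \<phi> p) = 0"
  have const: "(LINT p|lborel. g p * \<phi> (p + t *\<^sub>R v)) = (LINT p|lborel. g p * \<phi> p)"
    if \<phi>: "\<phi> \<in> test_functions" for \<phi> t
  proof -
    let ?u = "\<lambda>t. LINT p|lborel. g p * \<phi> (p + t *\<^sub>R v)"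
    have "(?u has_derivative (\<lambda>h. 0)) (at t)" for t
      unfolding has_derivative_at
    proof
      have \<psi>: "(\<lambda>p. \<phi> (p + t *\<^sub>R v)) \<in> test_functions" by (rule test_translate[OF \<phi>])
      have "((\<lambda>s. ((LINT p|lborel. g p * \<phi> (p + s *\<^sub>R v + t *\<^sub>R v)) - ?u t) / complex_of_real s) \<longlongrightarrow> 0) (at 0)"
        using translation_derivative[OF g \<psi>, of v] zero \<psi> by simp
      then have "((\<lambda>s. norm (((LINT p|lborel. g p * \<phi> (p + s *\<^sub>R v + t *\<^sub>R v)) - ?u t) / complex_of_real s)) \<longlongrightarrow> 0) (at 0)"
        by (rule tendsto_norm_zero)
      moreover have "norm (((LINT p|lborel. g p * \<phi> (p + s *\<^sub>R v + t *\<^sub>R v)) - ?u t) / complex_of_real s)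
          = norm (?u (t + s) - ?u t - 0) / norm s" for s
      proof -
        have eq: "p + s *\<^sub>R v + t *\<^sub>R v = p + (t + s) *\<^sub>R v" for p
          by (simp add: scaleR_left_distrib)
        show ?thesis unfolding eq by (simp add: norm_divide)
      qed
      ultimately show "((\<lambda>s. norm (?u (t + s) - ?u t - 0) / norm s) \<longlongrightarrow> 0) (at 0)"
        by (simp only:)
    qed (rule bounded_linear_zero)
    then have "?u t = ?u 0"
      by (intro has_derivative_zero_unique[where s = UNIV and f = ?u]) auto
    then show ?thesis by simp
  qed
  show "\<forall>p t. g (p + t *\<^sub>R v) = g p"
  proof (intro allI)
    fix p t
    let ?d = "\<lambda>p. g (p - (- t) *\<^sub>R v) - g p"
    have c: "continuous_on UNIV (\<lambda>p. g (p - (- t) *\<^sub>R v))"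
      by (rule continuous_on_compose2[OF g]) (auto intro!: continuous_intros)
    have "?d p = 0"
    proof (rule continuous_zero_if_tested_zero[where g = ?d])
      show "continuous_on UNIV ?d" by (intro continuous_on_diff c g)
      fix \<phi> :: "'a \<Rightarrow> complex" assume \<phi>: "\<phi> \<in> test_functions"
      have "(LINT p|lborel. ?d p * \<phi> p)
         = (LINT p|lborel. g (p - (- t) *\<^sub>R v) * \<phi> p) - (LINT p|lborel. g p * \<phi> p)"
        using integrable_continuous_test[OF c \<phi>] integrable_continuous_test[OF g \<phi>]
        by (simp only: left_diff_distrib Bochner_Integration.integral_diff)
      then show "(LINT p|lborel. ?d p * \<phi> p) = 0"
        using const[OF \<phi>, of "- t"] integral_translate_test[OF g \<phi>, of "(- t) *\<^sub>R v"] by simp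
    qed
    then show "g (p + t *\<^sub>R v) = g p" by simp
  qed
qed

section \<open>The equations as a factorization property\<close>

text \<open>
  The mixed second difference of \<open>log F\<close> with steps \<open>a\<close> and \<open>b\<close> vanishes, stated multiplicatively
  because \<open>F\<close> is complex-valued and need not have a distinguished logarithm.
\<close>

definition splits_along :: "('a::real_vector \<Rightarrow> complex) \<Rightarrow> 'a \<Rightarrow> 'a \<Rightarrow> bool" where
  "splits_along F a b \<longleftrightarrow> (\<forall>p. F (p + a + b) * F p = F (p + a) * F (p + b))"

lemma splits_along_commute: "splits_along F a b \<longleftrightarrow> splits_along F b a"
  unfolding splits_along_def by (simp add: ac_simps)

lemma splits_along_add:
  assumes nz: "\<And>p. F p \<noteq> 0" and 1: "splits_along F a b" and 2: "splits_along F a' b"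
  shows "splits_along F (a + a') b"
  unfolding splits_along_def
proof
  fix p
  have "F (p + a + a' + b) * F (p + a) = F (p + a + a') * F (p + a + b)"
    using 2 by (simp add: splits_along_def)
  then have "F (p + a) * (F (p + a + a' + b) * F p) = F (p + a + a') * (F (p + a + b) * F p)"
    by (simp add: ac_simps)
  also have "\<dots> = F (p + a) * (F (p + a + a') * F (p + b))"
    using 1[unfolded splits_along_def, rule_format, of p] by simp
  finally show "F (p + (a + a') + b) * F p = F (p + (a + a')) * F (p + b)"
    using nz[of "p + a"] by (simp add: ac_simps)
qed

lemma splits_along_sum:
  assumes nz: "\<And>p. F p \<noteq> 0" and fin: "finite I" and s: "\<And>i. i \<in> I \<Longrightarrow> splits_along F (a i) b"
  shows "splits_along F (sum a I) b"
  using fin s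
proof (induction I)
  case empty
  then show ?case by (simp add: splits_along_def)
next
  case (insert i I)
  then show ?case by (auto intro!: splits_along_add[OF nz])
qed

context
  fixes F :: "'a::euclidean_space \<Rightarrow> complex"
  assumes C1: "Ck 1 F" and nz: "\<And>p. F p \<noteq> 0"
begin

lemma C1_differentiable: "F differentiable (at p)" and C1_continuous: "continuous_on UNIV F"
  and C1_dir_deriv: "continuous_on UNIV (dir_deriv v F)"
  using C1 Ck_imp_continuous[OF C1] by auto

lemma log_deriv_continuous: "continuous_on UNIV (\<lambda>p. dir_deriv v F p / F p)"
  by (intro continuous_on_divide C1_dir_deriv C1_continuous) (use nz in auto)

text \<open>
  The distribution \<open>\<partial>\<^sub>v (\<partial>\<^sub>w F / F)\<close> on test functions, up to the sign.
\<close>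

definition log_hess :: "'a \<Rightarrow> 'a \<Rightarrow> ('a \<Rightarrow> complex) \<Rightarrow> complex" where
  "log_hess v w \<phi> = (LINT p|lborel. dir_deriv w F p / F p * dir_deriv v \<phi> p)"

lemma distr_deriv_log_deriv:
  "distr_deriv v (distr_of (\<lambda>p. dir_deriv w F p / F p)) \<phi> = - log_hess v w \<phi>"
  by (simp add: distr_deriv_def distr_of_def log_hess_def)

lemma integrable_log_hess:
  "\<phi> \<in> test_functions \<Longrightarrow> integrable lborel (\<lambda>p. dir_deriv w F p / F p * dir_deriv v \<phi> p)"
  by (rule integrable_continuous_test[OF log_deriv_continuous test_dir_deriv])

lemma log_hess_linear_left:
  assumes \<phi>: "\<phi> \<in> test_functions"
  shows "log_hess (a *\<^sub>R v + b *\<^sub>R v') w \<phi> = complex_of_real a * log_hess v w \<phi> + complex_of_real b * log_hess v' w \<phi>"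
proof -
  have "log_hess (a *\<^sub>R v + b *\<^sub>R v') w \<phi> = (LINT p|lborel.
      complex_of_real a * (dir_deriv w F p / F p * dir_deriv v \<phi> p)
      + complex_of_real b * (dir_deriv w F p / F p * dir_deriv v' \<phi> p))"
    unfolding log_hess_def dir_deriv_linear[OF differentiable_test[OF \<phi>]] by (simp add: algebra_simps)
  also have "\<dots> = complex_of_real a * log_hess v w \<phi> + complex_of_real b * log_hess v' w \<phi>"
    unfolding log_hess_def
    by (subst Bochner_Integration.integral_add) (intro integrable_mult_right integrable_log_hess \<phi>, intro integrable_mult_right integrable_log_hess \<phi>, simp only: integral_mult_right_zero)
  finally show ?thesis .
qed

lemma log_hess_linear_right:
  assumes \<phi>: "\<phi> \<in> test_functions"
  shows "log_hess v (a *\<^sub>R w + b *\<^sub>R w') \<phi> = complex_of_real a * log_hess v w \<phi> + complex_of_real b * log_hess v w' \<phi>"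
proof -
  have "log_hess v (a *\<^sub>R w + b *\<^sub>R w') \<phi> = (LINT p|lborel.
      complex_of_real a * (dir_deriv w F p / F p * dir_deriv v \<phi> p)
      + complex_of_real b * (dir_deriv w' F p / F p * dir_deriv v \<phi> p))"
    unfolding log_hess_def dir_deriv_linear[OF C1_differentiable]
    by (simp add: algebra_simps add_divide_distrib)
  also have "\<dots> = complex_of_real a * log_hess v w \<phi> + complex_of_real b * log_hess v w' \<phi>"
    unfolding log_hess_def
    by (subst Bochner_Integration.integral_add) (intro integrable_mult_right integrable_log_hess \<phi>, intro integrable_mult_right integrable_log_hess \<phi>, simp only: integral_mult_right_zero)
  finally show ?thesis .
qed

text \<open>
  Both sides say that \<open>\<partial>\<^sub>w F / F\<close> is invariant under translations along \<open>v\<close>; the quotient of \<open>F\<close> at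
  points that differ by a multiple of \<open>v\<close> is then constant along \<open>w\<close>.
\<close>

lemma log_hess_zero_iff:
  "(\<forall>\<phi>\<in>test_functions. log_hess v w \<phi> = 0) \<longleftrightarrow> (\<forall>s t. splits_along F (s *\<^sub>R w) (t *\<^sub>R v))"
  unfolding log_hess_def distr_deriv_zero_iff_invariant[OF log_deriv_continuous]
proof
  assume inv: "\<forall>p t. dir_deriv w F (p + t *\<^sub>R v) / F (p + t *\<^sub>R v) = dir_deriv w F p / F p"
  show "\<forall>s t. splits_along F (s *\<^sub>R w) (t *\<^sub>R v)"
    unfolding splits_along_def
  proof (intro allI)
    fix s t p
    let ?N = "\<lambda>s. F (p + t *\<^sub>R v + s *\<^sub>R w)" and ?D = "\<lambda>s. F (p + s *\<^sub>R w)"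
    have "((\<lambda>s. ?N s / ?D s) has_vector_derivative 0) (at s within UNIV)" for s
    proof -
      have e: "dir_deriv w F (p + t *\<^sub>R v + s *\<^sub>R w) * ?D s = ?N s * dir_deriv w F (p + s *\<^sub>R w)"
        using inv[rule_format, of "p + s *\<^sub>R w" t] nz[of "p + s *\<^sub>R w"] nz[of "p + s *\<^sub>R w + t *\<^sub>R v"]
        by (simp add: field_simps)
      have N: "(?N has_derivative (\<lambda>h. h *\<^sub>R dir_deriv w F (p + t *\<^sub>R v + s *\<^sub>R w))) (at s)"
        using has_vector_derivative_line[OF C1_differentiable] by (simp add: has_vector_derivative_def)
      have D: "(?D has_derivative (\<lambda>h. h *\<^sub>R dir_deriv w F (p + s *\<^sub>R w))) (at s)"
        using has_vector_derivative_line[OF C1_differentiable] by (simp add: has_vector_derivative_def)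
      show ?thesis
        unfolding has_vector_derivative_def
        by (rule has_derivative_eq_rhs[OF has_derivative_divide'[OF N D]])
          (use e nz in \<open>auto simp: fun_eq_iff scaleR_conv_of_real algebra_simps\<close>)
    qed
    then have "(\<lambda>s. ?N s / ?D s) s = (\<lambda>s. ?N s / ?D s) 0"
      by (intro has_derivative_zero_unique[where s = UNIV])
        (auto simp: has_vector_derivative_def)
    then show "F (p + s *\<^sub>R w + t *\<^sub>R v) * F p = F (p + s *\<^sub>R w) * F (p + t *\<^sub>R v)"
      using nz[of "p + s *\<^sub>R w"] nz[of p] by (simp add: field_simps)
  qed
next
  assume spl: "\<forall>s t. splits_along F (s *\<^sub>R w) (t *\<^sub>R v)"
  show "\<forall>p t. dir_deriv w F (p + t *\<^sub>R v) / F (p + t *\<^sub>R v) = dir_deriv w F p / F p"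
  proof (intro allI)
    fix p t
    have "F (p + t *\<^sub>R v + s *\<^sub>R w) * F p = F (p + s *\<^sub>R w) * F (p + t *\<^sub>R v)" for s
      using spl by (simp add: splits_along_def ac_simps)
    then have eq: "(\<lambda>s. F (p + t *\<^sub>R v + s *\<^sub>R w) * F p) = (\<lambda>s. F (p + s *\<^sub>R w) * F (p + t *\<^sub>R v))"
      by (rule ext)
    have "((\<lambda>s. F (p + t *\<^sub>R v + s *\<^sub>R w) * F p) has_vector_derivative dir_deriv w F (p + t *\<^sub>R v) * F p) (at 0)"
      using has_vector_derivative_mult_left[OF has_vector_derivative_line[where p = "p + t *\<^sub>R v" and s = 0 and v = w, OF C1_differentiable]]
      by simp
    moreover have "((\<lambda>s. F (p + s *\<^sub>R w) * F (p + t *\<^sub>R v)) has_vector_derivative dir_deriv w F p * F (p + t *\<^sub>R v)) (at 0)"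
      using has_vector_derivative_mult_left[OF has_vector_derivative_line[where p = p and s = 0 and v = w, OF C1_differentiable]]
      by simp
    ultimately have "dir_deriv w F (p + t *\<^sub>R v) * F p = dir_deriv w F p * F (p + t *\<^sub>R v)"
      unfolding eq by (rule vector_derivative_unique_at)
    then show "dir_deriv w F (p + t *\<^sub>R v) / F (p + t *\<^sub>R v) = dir_deriv w F p / F p"
      using nz by (simp add: field_simps)
  qed
qed

end

text \<open>
  The kernel variables have \<open>\<partial>\<^sub>X = \<partial>\<^sub>x / 2 - \<partial>\<^sub>y / h\<close> and \<open>\<partial>\<^sub>Y = \<partial>\<^sub>x / 2 + \<partial>\<^sub>y / h\<close>. Expanding the two mixed
  second derivatives of \<open>log F\<close> in \<open>X\<close> and \<open>Y\<close> shows that the vanishing of their sum and of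
  their difference are the two equations in \<open>x\<close> and \<open>y\<close>.
\<close>

lemma log_hess_kernel_coord:
  fixes F :: "(real^'n) \<times> (real^'n) \<Rightarrow> complex"
  assumes C1: "Ck 1 F" and nz: "\<And>p. F p \<noteq> 0" and \<phi>: "\<phi> \<in> test_functions"
  shows "log_hess F (kernel_coord h (0, b)) (kernel_coord h (a, 0)) \<phi>
      = log_hess F (b, 0) (a, 0) \<phi> / 4 - log_hess F (b, 0) (0, a) \<phi> / of_real (2 * h)
        + log_hess F (0, b) (a, 0) \<phi> / of_real (2 * h) - log_hess F (0, b) (0, a) \<phi> / of_real (h\<^sup>2)"
    and "log_hess F (kernel_coord h (b, 0)) (kernel_coord h (0, a)) \<phi>
      = log_hess F (b, 0) (a, 0) \<phi> / 4 + log_hess F (b, 0) (0, a) \<phi> / of_real (2 * h)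
        - log_hess F (0, b) (a, 0) \<phi> / of_real (2 * h) - log_hess F (0, b) (0, a) \<phi> / of_real (h\<^sup>2)"
proof -
  have k: "kernel_coord h (c, 0) = (1 / 2) *\<^sub>R (c, 0) + (- 1 / h) *\<^sub>R (0, c)"
    "kernel_coord h (0, c) = (1 / 2) *\<^sub>R (c, 0) + (1 / h) *\<^sub>R (0, c)" for c :: "real^'n"
    by (simp_all add: kernel_coord_def)
  note lin = log_hess_linear_left[OF C1 nz \<phi>] log_hess_linear_right[OF C1 nz \<phi>]
  show "log_hess F (kernel_coord h (0, b)) (kernel_coord h (a, 0)) \<phi>
      = log_hess F (b, 0) (a, 0) \<phi> / 4 - log_hess F (b, 0) (0, a) \<phi> / of_real (2 * h)
        + log_hess F (0, b) (a, 0) \<phi> / of_real (2 * h) - log_hess F (0, b) (0, a) \<phi> / of_real (h\<^sup>2)"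
    and "log_hess F (kernel_coord h (b, 0)) (kernel_coord h (0, a)) \<phi>
      = log_hess F (b, 0) (a, 0) \<phi> / 4 + log_hess F (b, 0) (0, a) \<phi> / of_real (2 * h)
        - log_hess F (0, b) (a, 0) \<phi> / of_real (2 * h) - log_hess F (0, b) (0, a) \<phi> / of_real (h\<^sup>2)"
    unfolding k lin by (simp_all add: power2_eq_square algebra_simps)
qed

lemma log_hess_equations_iff:
  fixes F :: "(real^'n) \<times> (real^'n) \<Rightarrow> complex"
  assumes h: "h > 0" and C1: "Ck 1 F" and nz: "\<And>p. F p \<noteq> 0"
  shows "(\<forall>j k.
      distr_eq
        (\<lambda>\<phi>. complex_of_real (4 / h\<^sup>2) *
              distr_deriv (dy j) (distr_of (\<lambda>p. dir_deriv (dy k) F p / F p)) \<phi>)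
        (distr_deriv (dx j) (distr_of (\<lambda>p. dir_deriv (dx k) F p / F p))) \<and>
      distr_eq
        (distr_deriv (dy j) (distr_of (\<lambda>p. dir_deriv (dx k) F p / F p)))
        (distr_deriv (dx j) (distr_of (\<lambda>p. dir_deriv (dy k) F p / F p))))
    \<longleftrightarrow> (\<forall>a b. splits_along F (kernel_coord h (a, 0)) (kernel_coord h (0, b)))"
    (is "?L \<longleftrightarrow> ?R")
proof
  note zero = log_hess_zero_iff[OF C1 nz]
  assume ?L
  then have 1: "complex_of_real (4 / h\<^sup>2) * log_hess F (dy j) (dy k) \<phi> = log_hess F (dx j) (dx k) \<phi>"
    and 2: "log_hess F (dy j) (dx k) \<phi> = log_hess F (dx j) (dy k) \<phi>"
    if "\<phi> \<in> test_functions" for \<phi> j k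
    using that by (simp_all add: distr_eq_def distr_deriv_log_deriv[OF C1 nz])
  have z: "splits_along F (s *\<^sub>R kernel_coord h (axis k 1, 0)) (t *\<^sub>R kernel_coord h (0, axis j 1))" for s t j k
  proof -
    have "log_hess F (kernel_coord h (0, axis j 1)) (kernel_coord h (axis k 1, 0)) \<phi> = 0"
      if "\<phi> \<in> test_functions" for \<phi>
      unfolding log_hess_kernel_coord[OF C1 nz that] using 1[OF that, of j k, symmetric] 2[OF that, of j k] by simp
    then show ?thesis using zero by blast
  qed
  have exp1: "kernel_coord h (a, 0) = (\<Sum>k\<in>UNIV. (a $ k) *\<^sub>R kernel_coord h (axis k 1, 0))"
    and exp2: "kernel_coord h (0, a) = (\<Sum>k\<in>UNIV. (a $ k) *\<^sub>R kernel_coord h (0, axis k 1))" for a :: "real^'n"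
  proof -
    have "a = (\<Sum>k\<in>UNIV. (a $ k) *\<^sub>R axis k 1)"
      using basis_expansion[of a] by (simp add: scalar_mult_eq_scaleR)
    then have "c *\<^sub>R a = (\<Sum>k\<in>UNIV. (a $ k) *\<^sub>R (c *\<^sub>R axis k 1))" for c :: real
      by (metis (no_types, lifting) scaleR_left_commute scaleR_sum_right sum.cong)
    from this[of "1 / 2"] this[of "1 / h"] this[of "- (1 / h)"]
    show "kernel_coord h (a, 0) = (\<Sum>k\<in>UNIV. (a $ k) *\<^sub>R kernel_coord h (axis k 1, 0))"
      "kernel_coord h (0, a) = (\<Sum>k\<in>UNIV. (a $ k) *\<^sub>R kernel_coord h (0, axis k 1))"
      by (simp_all add: kernel_coord_def prod_eq_iff fst_sum snd_sum)
  qed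
  show ?R
  proof (intro allI)
    fix a b :: "real^'n"
    have 3: "splits_along F ((a $ k) *\<^sub>R kernel_coord h (axis k 1, 0)) (kernel_coord h (0, b))" for k
      unfolding exp2[of b]
      by (subst splits_along_commute) (intro splits_along_sum nz finite, subst splits_along_commute, rule z)
    show "splits_along F (kernel_coord h (a, 0)) (kernel_coord h (0, b))"
      unfolding exp1[of a] by (intro splits_along_sum nz finite 3)
  qed
next
  note zero = log_hess_zero_iff[OF C1 nz]
  assume R: ?R
  have sc: "s *\<^sub>R kernel_coord h p = kernel_coord h (s *\<^sub>R p)" for s :: real and p :: "(real^'n) \<times> (real^'n)"
    by (simp add: kernel_coord_def scaleR_right_distrib scaleR_right_diff_distrib ac_simps split: prod.split)
  have z1: "log_hess F (kernel_coord h (0, b)) (kernel_coord h (a, 0)) \<phi> = 0"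
    and z2: "log_hess F (kernel_coord h (b, 0)) (kernel_coord h (0, a)) \<phi> = 0"
    if "\<phi> \<in> test_functions" for \<phi> a b
  proof -
    have "splits_along F (s *\<^sub>R kernel_coord h (a, 0)) (t *\<^sub>R kernel_coord h (0, b))" for s t
      unfolding sc using R by simp
    then show "log_hess F (kernel_coord h (0, b)) (kernel_coord h (a, 0)) \<phi> = 0"
      using zero that by blast
    have "splits_along F (s *\<^sub>R kernel_coord h (0, a)) (t *\<^sub>R kernel_coord h (b, 0))" for s t
      unfolding sc using R by (subst splits_along_commute) simp
    then show "log_hess F (kernel_coord h (b, 0)) (kernel_coord h (0, a)) \<phi> = 0"
      using zero that by blast
  qed
  have eqs: "complex_of_real (4 / h\<^sup>2) * log_hess F (dy j) (dy k) \<phi> = log_hess F (dx j) (dx k) \<phi>"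
    "log_hess F (dy j) (dx k) \<phi> = log_hess F (dx j) (dy k) \<phi>"
    if "\<phi> \<in> test_functions" for \<phi> j k
  proof -
    let ?A = "log_hess F (dx j) (dx k) \<phi>" and ?B = "log_hess F (dy j) (dy k) \<phi>"
      and ?C = "log_hess F (dx j) (dy k) \<phi>" and ?D = "log_hess F (dy j) (dx k) \<phi>"
    have e1: "?A / 4 - ?C / of_real (2 * h) + ?D / of_real (2 * h) - ?B / of_real (h\<^sup>2) = 0"
      using z1[OF that, of "axis j 1" "axis k 1"] unfolding log_hess_kernel_coord[OF C1 nz that] .
    have e2: "?A / 4 + ?C / of_real (2 * h) - ?D / of_real (2 * h) - ?B / of_real (h\<^sup>2) = 0"
      using z2[OF that, of "axis j 1" "axis k 1"] unfolding log_hess_kernel_coord[OF C1 nz that] .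
    have aux: "a = b \<and> d = c" if "a - c + d - b = 0" "a + c - d - b = 0" for a b c d :: complex
    proof -
      have "2 * (a - b) = (a - c + d - b) + (a + c - d - b)"
        "2 * (d - c) = (a - c + d - b) - (a + c - d - b)" by (simp_all add: algebra_simps)
      then show ?thesis unfolding that by simp
    qed
    have "?A / 4 = ?B / of_real (h\<^sup>2)" using aux[OF e1 e2] by simp
    then show "complex_of_real (4 / h\<^sup>2) * ?B = ?A" using h by (simp add: field_simps)
    have "?D / of_real (2 * h) = ?C / of_real (2 * h)" using aux[OF e1 e2] by simp
    then show "?D = ?C" using h by simp
  qed
  show ?L
    using eqs by (auto simp: distr_eq_def distr_deriv_log_deriv[OF C1 nz])
qed


section \<open>Operators with a continuous kernel\<close>

lemma kernel_coord_add: "kernel_coord h (p + q) = kernel_coord h p + kernel_coord h q"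
  by (auto simp: kernel_coord_def scaleR_right_distrib scaleR_right_diff_distrib split: prod.split)

lemma splits_along_kernel_iff:
  fixes F :: "'a::euclidean_space \<times> 'a \<Rightarrow> complex"
  assumes h: "h \<noteq> 0"
  shows "(\<forall>a b. splits_along F (kernel_coord h (a, 0)) (kernel_coord h (0, b))) \<longleftrightarrow>
    (\<forall>X X' Y Y'. F (kernel_coord h (X, Y)) * F (kernel_coord h (X', Y'))
      = F (kernel_coord h (X, Y')) * F (kernel_coord h (X', Y)))"
proof
  assume s: "\<forall>a b. splits_along F (kernel_coord h (a, 0)) (kernel_coord h (0, b))"
  show "\<forall>X X' Y Y'. F (kernel_coord h (X, Y)) * F (kernel_coord h (X', Y'))
      = F (kernel_coord h (X, Y')) * F (kernel_coord h (X', Y))"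
  proof (intro allI)
    fix X X' Y Y' :: 'a
    from s have "splits_along F (kernel_coord h (X - X', 0)) (kernel_coord h (0, Y - Y'))" by blast
    from this[unfolded splits_along_def, rule_format, of "kernel_coord h (X', Y')"]
    show "F (kernel_coord h (X, Y)) * F (kernel_coord h (X', Y'))
      = F (kernel_coord h (X, Y')) * F (kernel_coord h (X', Y))"
      by (simp add: kernel_coord_add[symmetric])
  qed
next
  assume r: "\<forall>X X' Y Y'. F (kernel_coord h (X, Y)) * F (kernel_coord h (X', Y'))
      = F (kernel_coord h (X, Y')) * F (kernel_coord h (X', Y))"
  show "\<forall>a b. splits_along F (kernel_coord h (a, 0)) (kernel_coord h (0, b))"
    unfolding splits_along_def
  proof (intro allI)
    fix a b :: 'a and p :: "'a \<times> 'a"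
    obtain X Y where XY: "wigner_coord h p = (X, Y)" by (cases "wigner_coord h p")
    have p: "p = kernel_coord h (X, Y)" using kernel_wigner_coord[OF h, of p] XY by simp
    show "F (p + kernel_coord h (a, 0) + kernel_coord h (0, b)) * F p
      = F (p + kernel_coord h (a, 0)) * F (p + kernel_coord h (0, b))"
      using r unfolding p kernel_coord_add[symmetric] by simp
  qed
qed

lemma AE_lborel_False: "\<not> (AE x in (lborel :: 'a::euclidean_space measure). False)"
  using ae_filter_eq_bot_iff[of "lborel :: 'a measure"] by (simp add: trivial_limit_def)

lemma AE_lborel_ex:
  assumes "AE x in (lborel :: 'a::euclidean_space measure). P x"
  shows "\<exists>x. P x"
  using assms AE_lborel_False by (metis (mono_tags, lifting) eventually_mono)

lemma L2_measurable: "f \<in> L2 \<Longrightarrow> f \<in> borel_measurable borel"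
  by (simp add: L2_def)

lemma L2_cnj: "f \<in> L2 \<Longrightarrow> (\<lambda>x. cnj (f x)) \<in> L2"
  by (auto simp: L2_def intro: borel_measurable_continuous_on[OF continuous_on_cnj[OF continuous_on_id]])

lemma integrable_norm_square: "f \<in> L2 \<Longrightarrow> integrable lborel (\<lambda>x. (cmod (f x))\<^sup>2)"
  by (simp add: L2_def)

lemma cnj_L2_inner:
  "cnj (L2_inner f g) = L2_inner g f"
  using Bochner_Integration.integral_cnj[of lborel "\<lambda>x. f x * cnj (g x)"]
  by (simp add: L2_inner_def mult.commute)

lemma L2_inner_self:
  assumes "f \<in> L2"
  shows "L2_inner f f = of_real (LINT x|lborel. (cmod (f x))\<^sup>2)"
  unfolding L2_inner_def complex_norm_square[symmetric] by (rule integral_complex_of_real)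

lemma integral_norm_square_pos:
  fixes f :: "'a::euclidean_space \<Rightarrow> complex"
  assumes "f \<in> L2" "\<And>x. f x \<noteq> 0"
  shows "(LINT x|lborel. (cmod (f x))\<^sup>2) > 0"
proof -
  have "(LINT x|lborel. (cmod (f x))\<^sup>2) \<noteq> 0"
  proof
    assume "(LINT x|lborel. (cmod (f x))\<^sup>2) = 0"
    then have "AE x in lborel. (cmod (f x))\<^sup>2 = 0"
      using integral_nonneg_eq_0_iff_AE[OF integrable_norm_square[OF assms(1)]] by simp
    then show False using assms(2) AE_lborel_False[where 'a = 'a] by simp
  qed
  moreover have "(LINT x|lborel. (cmod (f x))\<^sup>2) \<ge> 0" by simp
  ultimately show ?thesis by linarith
qed

text \<open>
  An operator whose square-integrable kernel has a continuous representative \<open>K\<close> without zeros.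
\<close>

locale continuous_kernel =
  fixes R :: "'a::euclidean_space operator" and r K :: "'a \<times> 'a \<Rightarrow> complex"
  assumes kernel: "integral_kernel R r"
    and r_eq: "AE p in lborel. r p = K p"
    and cont: "continuous_on UNIV K"
    and nonzero: "\<And>p. K p \<noteq> 0"
begin

lemma r_L2: "r \<in> L2"
  using kernel by (simp add: integral_kernel_def)

lemma K_measurable: "K \<in> borel_measurable borel"
  using cont by (rule borel_measurable_continuous_onI)

lemma K_section_continuous: "continuous_on UNIV (\<lambda>Y. K (X, Y))" "continuous_on UNIV (\<lambda>X. K (X, Y))"
  by (auto intro!: continuous_on_compose2[OF cont] continuous_intros)

lemma section_measurable:
  fixes f :: "'a \<times> 'a \<Rightarrow> complex"
  assumes "f \<in> borel_measurable borel"
  shows "(\<lambda>Y. f (X, Y)) \<in> borel_measurable (borel :: 'a measure)"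
  using assms measurable_Pair2[of f lborel lborel borel X] by (simp add: lborel_prod)

lemma operator_eq:
  assumes f: "f \<in> L2"
  shows "AE X in lborel. R f X = (LINT Y|lborel. K (X, Y) * f Y)"
proof -
  have fm [measurable]: "f \<in> borel_measurable borel" using f by (rule L2_measurable)
  have "AE X in lborel. R f X = (LINT Y|lborel. r (X, Y) * f Y)"
    using kernel f by (simp add: integral_kernel_def ae_eq_def)
  moreover have "AE X in lborel. AE Y in lborel. r (X, Y) = K (X, Y)"
    by (rule AE_lborel_prodD[OF r_eq])
  ultimately show ?thesis
  proof eventually_elim
    case (elim X)
    have [measurable]: "(\<lambda>Y. r (X, Y)) \<in> borel_measurable borel" "(\<lambda>Y. K (X, Y)) \<in> borel_measurable borel"
      using section_measurable[OF L2_measurable[OF r_L2]] section_measurable[OF K_measurable] by auto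
    have "(LINT Y|lborel. r (X, Y) * f Y) = (LINT Y|lborel. K (X, Y) * f Y)"
      by (rule integral_cong_AE) (use elim(2) in \<open>auto elim!: eventually_mono\<close>)
    then show ?case using elim(1) by simp
  qed
qed

text \<open>The continuous representative of the image of a test function.\<close>

definition image_fun :: "('a \<Rightarrow> complex) \<Rightarrow> 'a \<Rightarrow> complex" where
  "image_fun f X = (LINT Y|lborel. K (X, Y) * f Y)"

lemma image_fun_continuous:
  assumes f: "f \<in> test_functions"
  shows "continuous_on UNIV (image_fun f)"
proof -
  from f obtain S where S: "compact S" "\<And>p. p \<notin> S \<Longrightarrow> f p = 0" by (auto simp: test_functions_def)
  obtain c where c: "S \<subseteq> cbox (- c) c"
    using bounded_subset_cbox_symmetric[OF compact_imp_bounded[OF S(1)]] by blast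
  have "image_fun f X = integral (cbox (- c) c) (\<lambda>Y. K (X, Y) * f Y)" for X
  proof -
    have eq: "(\<lambda>Y. indicator (cbox (- c) c) Y *\<^sub>R (K (X, Y) * f Y)) = (\<lambda>Y. K (X, Y) * f Y)"
      using c S(2) by (auto simp: fun_eq_iff indicator_def)
    have "set_integrable lborel (cbox (- c) c) (\<lambda>Y. K (X, Y) * f Y)"
      unfolding set_integrable_def eq by (rule integrable_continuous_test[OF K_section_continuous(1) f])
    from set_borel_integral_eq_integral(2)[OF this]
    show ?thesis unfolding set_lebesgue_integral_def eq image_fun_def by simp
  qed
  moreover have "continuous_on UNIV (\<lambda>X. integral (cbox (- c) c) (\<lambda>Y. K (X, Y) * f Y))"
    by (rule integral_continuous_on_param)
      (auto simp: case_prod_unfold intro!: continuous_on_mult continuous_on_subset[OF cont]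
        continuous_on_compose2[OF continuous_test[OF f]] continuous_intros)
  ultimately show ?thesis by simp
qed

text \<open>
  If the rank is one, the images of any two test functions are proportional. A continuous function is
  determined by its integrals against test functions, so the columns of the kernel are proportional,
  too.
\<close>

lemma rank_one_imp_factorizes:
  assumes "rank_one R"
  shows "K (X, Y) * K (X', Y') = K (X, Y') * K (X', Y)"
proof -
  from assms obtain h where h: "\<And>f. f \<in> L2 \<Longrightarrow> \<exists>c. AE X in lborel. R f X = c * R h X"
    unfolding rank_one_def ae_eq_def by blast
  have proportional: "image_fun f X * image_fun g X' = image_fun f X' * image_fun g X"
    if f: "f \<in> test_functions" and g: "g \<in> test_functions" for f g X X'
  proof -
    obtain c d where c: "AE X in lborel. R f X = c * R h X" and d: "AE X in lborel. R g X = d * R h X"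
      using h[OF test_in_L2[OF f]] h[OF test_in_L2[OF g]] by blast
    have c': "AE X in lborel. image_fun f X = c * R h X" and d': "AE X in lborel. image_fun g X = d * R h X"
      using c operator_eq[OF test_in_L2[OF f]] d operator_eq[OF test_in_L2[OF g]]
      unfolding image_fun_def by (eventually_elim; simp)+
    note cf = image_fun_continuous[OF f] and cg = image_fun_continuous[OF g]
    show ?thesis
    proof (cases "c = 0")
      case True
      then have "AE X in lborel. image_fun f X = 0" using c' by simp
      from AE_eq_continuous_imp_eq[OF this cf continuous_on_const] show ?thesis by simp
    next
      case False
      have "AE X in lborel. image_fun g X = d / c * image_fun f X"
        using c' d' by eventually_elim (use False in simp)
      from AE_eq_continuous_imp_eq[OF this cg continuous_on_mult[OF continuous_on_const cf]]
      show ?thesis by simp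
    qed
  qed
  have col: "K (X, Y) * image_fun g X' - K (X', Y) * image_fun g X = 0"
    if g: "g \<in> test_functions" for g X X' Y
  proof (rule continuous_zero_if_tested_zero[where g = "\<lambda>Y. K (X, Y) * image_fun g X' - K (X', Y) * image_fun g X"])
    show "continuous_on UNIV (\<lambda>Y. K (X, Y) * image_fun g X' - K (X', Y) * image_fun g X)"
      by (intro continuous_intros K_section_continuous)
    fix f :: "'a \<Rightarrow> complex" assume f: "f \<in> test_functions"
    have i: "integrable lborel (\<lambda>Y. K (X, Y) * f Y)" for X
      by (rule integrable_continuous_test[OF K_section_continuous(1) f])
    have "(LINT Y|lborel. (K (X, Y) * image_fun g X' - K (X', Y) * image_fun g X) * f Y)
        = (LINT Y|lborel. (K (X, Y) * f Y) * image_fun g X' - (K (X', Y) * f Y) * image_fun g X)"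
      by (simp add: algebra_simps)
    also have "\<dots> = image_fun f X * image_fun g X' - image_fun f X' * image_fun g X"
      unfolding image_fun_def[of f] using i
      by (subst Bochner_Integration.integral_diff) (auto simp only: integral_mult_left_zero intro!: integrable_mult_left i)
    also have "\<dots> = 0" using proportional[OF f g, of X X'] by simp
    finally show "(LINT Y|lborel. (K (X, Y) * image_fun g X' - K (X', Y) * image_fun g X) * f Y) = 0" .
  qed
  have "K (X, Y) * K (X', Y') - K (X', Y) * K (X, Y') = 0"
  proof (rule continuous_zero_if_tested_zero[where g = "\<lambda>Y'. K (X, Y) * K (X', Y') - K (X', Y) * K (X, Y')"])
    show "continuous_on UNIV (\<lambda>Y'. K (X, Y) * K (X', Y') - K (X', Y) * K (X, Y'))"
      by (intro continuous_intros K_section_continuous)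
    fix g :: "'a \<Rightarrow> complex" assume g: "g \<in> test_functions"
    have i: "integrable lborel (\<lambda>Y. K (X, Y) * g Y)" for X
      by (rule integrable_continuous_test[OF K_section_continuous(1) g])
    have "(LINT Y'|lborel. (K (X, Y) * K (X', Y') - K (X', Y) * K (X, Y')) * g Y')
        = (LINT Y'|lborel. K (X, Y) * (K (X', Y') * g Y') - K (X', Y) * (K (X, Y') * g Y'))"
      by (simp add: algebra_simps)
    also have "\<dots> = K (X, Y) * image_fun g X' - K (X', Y) * image_fun g X"
      unfolding image_fun_def[of g] using i
      by (subst Bochner_Integration.integral_diff) (auto simp only: integral_mult_right_zero intro!: integrable_mult_right i)
    also have "\<dots> = 0" by (rule col[OF g])
    finally show "(LINT Y'|lborel. (K (X, Y) * K (X', Y') - K (X', Y) * K (X, Y')) * g Y') = 0" .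
  qed
  then show ?thesis by (simp add: mult.commute)
qed

text \<open>
  If the kernel is a product \<open>a X * b Y\<close>, then \<open>R f\<close> is the multiple of \<open>a\<close> by the integral of \<open>b * f\<close>.
  Self-adjointness makes this factor a real multiple \<open>\<kappa>\<close> of the inner product of \<open>f\<close> with \<open>a\<close>, so
  that the quadratic form of \<open>R\<close> has the sign of \<open>\<kappa>\<close>, and the trace condition makes \<open>\<kappa>\<close> positive.
\<close>

lemma factorizes_imp_rank_one:
  assumes fac: "\<And>X X' Y Y'. K (X, Y) * K (X', Y') = K (X, Y') * K (X', Y)"
    and tc: "trace_class R" and sa: "self_adjoint R" and tr: "op_trace R = 1"
  shows "rank_one R \<and> density_operator R"
proof -
  have bd: "bounded_operator R" using tc by (simp add: trace_class_def)
  then have RL: "R f \<in> L2" if "f \<in> L2" for f using that by (simp add: bounded_operator_def)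
  define a where "a X = K (X, 0)" for X
  define b where "b Y = K (0, Y) / K (0, 0)" for Y
  have Kab: "K (X, Y) = a X * b Y" for X Y
    using fac[of X Y 0 0] nonzero[of "(0, 0)"] by (simp add: a_def b_def field_simps)
  have a0: "a X \<noteq> 0" and b0: "b X \<noteq> 0" for X by (auto simp: a_def b_def nonzero)
  have ac: "continuous_on UNIV a" unfolding a_def[abs_def] by (rule K_section_continuous(2))
  have bc: "continuous_on UNIV b" unfolding b_def[abs_def]
    by (intro continuous_intros K_section_continuous(1)) (simp add: nonzero)
  have am [measurable]: "a \<in> borel_measurable borel" and bm [measurable]: "b \<in> borel_measurable borel"
    using ac bc by (auto intro: borel_measurable_continuous_onI)
  have bL: "b \<in> L2"
  proof -
    have "integrable lborel (\<lambda>p. complex_of_real ((cmod (r p))\<^sup>2))"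
      by (rule integrable_of_real[OF integrable_norm_square[OF r_L2]])
    then have "AE X in lborel. integrable lborel (\<lambda>Y. complex_of_real ((cmod (r (X, Y)))\<^sup>2))"
      by (rule integrable_lborel_prodD(1))
    moreover have "AE X in lborel. AE Y in lborel. r (X, Y) = K (X, Y)"
      by (rule AE_lborel_prodD[OF r_eq])
    ultimately have "AE X in lborel. integrable lborel (\<lambda>Y. complex_of_real ((cmod (r (X, Y)))\<^sup>2)) \<and>
        (AE Y in lborel. r (X, Y) = K (X, Y))" by eventually_elim simp
    then obtain X where X: "integrable lborel (\<lambda>Y. complex_of_real ((cmod (r (X, Y)))\<^sup>2))"
      "AE Y in lborel. r (X, Y) = K (X, Y)" using AE_lborel_ex by blast
    have "integrable lborel (\<lambda>Y. complex_of_real ((cmod (a X))\<^sup>2) * complex_of_real ((cmod (b Y))\<^sup>2))"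
    proof (rule integrable_cong_AE_imp[OF X(1)])
      show "AE Y in lborel. complex_of_real ((cmod (r (X, Y)))\<^sup>2)
          = complex_of_real ((cmod (a X))\<^sup>2) * complex_of_real ((cmod (b Y))\<^sup>2)"
        using X(2) by eventually_elim (simp add: Kab norm_mult power_mult_distrib)
    qed measurable
    then have "integrable lborel (\<lambda>Y. complex_of_real ((cmod (b Y))\<^sup>2))"
      using a0[of X] by (subst (asm) integrable_complex_mult_iff) auto
    then show ?thesis using integrable_Re by (fastforce simp: L2_def)
  qed
  define I where "I f = (LINT Y|lborel. b Y * f Y)" for f
  have Rf: "AE X in lborel. R f X = I f * a X" if "f \<in> L2" for f
    using operator_eq[OF that]
  proof eventually_elim
    case (elim X)
    have "(LINT Y|lborel. K (X, Y) * f Y) = (LINT Y|lborel. a X * (b Y * f Y))"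
      by (simp add: Kab mult.assoc)
    then show ?case using elim by (simp add: I_def mult.commute)
  qed
  \<comment> \<open>A vector with nonzero image, which also shows that \<open>a\<close> is square integrable\<close>
  define h where "h Y = cnj (b Y)" for Y
  have hL: "h \<in> L2" unfolding h_def[abs_def] by (rule L2_cnj[OF bL])
  have Ih: "I h \<noteq> 0"
  proof -
    have "I h = L2_inner b b" by (simp add: I_def h_def L2_inner_def)
    then show ?thesis
      using L2_inner_self[OF bL] integral_norm_square_pos[OF bL b0] by simp
  qed
  have aL: "a \<in> L2"
  proof -
    have "integrable lborel (\<lambda>X. (cmod (R h X))\<^sup>2)" by (rule integrable_norm_square[OF RL[OF hL]])
    then have "integrable lborel (\<lambda>X. (cmod (I h * a X))\<^sup>2)"
      by (rule integrable_cong_AE_imp) (use Rf[OF hL] in \<open>auto elim!: eventually_mono\<close>)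
    then have "integrable lborel (\<lambda>X. (cmod (I h))\<^sup>2 * (cmod (a X))\<^sup>2)"
      by (simp add: norm_mult power_mult_distrib)
    then show ?thesis using Ih by (simp add: L2_def)
  qed
  have rank: "rank_one R"
    unfolding rank_one_def ae_eq_def
  proof (intro bexI[OF _ hL] conjI ballI)
    show "\<not> (AE x in lborel. R h x = 0)"
    proof
      assume "AE x in lborel. R h x = 0"
      then have "AE x in (lborel :: 'a measure). False"
        using Rf[OF hL] by eventually_elim (use Ih a0 in auto)
      then show False using AE_lborel_False by blast
    qed
    fix f :: "'a \<Rightarrow> complex" assume f: "f \<in> L2"
    show "\<exists>c. AE x in lborel. R f x = c * R h x"
    proof
      show "AE x in lborel. R f x = I f / I h * R h x"
        using Rf[OF hL] Rf[OF f] by eventually_elim (use Ih in simp)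
    qed
  qed
  define N where "N = (LINT x|lborel. (cmod (a x))\<^sup>2)"
  have N: "N > 0" "L2_inner a a = of_real N"
    using integral_norm_square_pos[OF aL a0] L2_inner_self[OF aL] by (auto simp: N_def)
  have inner: "L2_inner (R f) g = I f * L2_inner a g" if f: "f \<in> L2" and g: "g \<in> L2" for f g
  proof -
    have [measurable]: "R f \<in> borel_measurable borel" "(\<lambda>X. cnj (g X)) \<in> borel_measurable borel"
      using RL[OF f] L2_cnj[OF g] by (auto intro: L2_measurable)
    have "L2_inner (R f) g = (LINT X|lborel. I f * (a X * cnj (g X)))"
      unfolding L2_inner_def
      by (rule integral_cong_AE) (use Rf[OF f] in \<open>auto elim!: eventually_mono\<close>)
    then show ?thesis by (simp add: L2_inner_def)
  qed
  define \<kappa> where "\<kappa> = cnj (I a) / of_real N"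
  have I_eq: "I f = \<kappa> * L2_inner f a" if f: "f \<in> L2" for f
  proof -
    have "I f * of_real N = L2_inner (R f) a" using inner[OF f aL] N by simp
    also have "\<dots> = L2_inner f (R a)"
      using sa f aL by (auto simp: self_adjoint_def is_adjoint_def)
    also have "\<dots> = cnj (L2_inner (R a) f)" by (simp add: cnj_L2_inner)
    also have "\<dots> = cnj (I a) * L2_inner f a" using inner[OF aL f] by (simp add: cnj_L2_inner)
    finally show ?thesis using N by (simp add: \<kappa>_def field_simps)
  qed
  have "cnj \<kappa> = \<kappa>"
  proof -
    have "I a = \<kappa> * of_real N" using I_eq[OF aL] N by simp
    moreover have "cnj (I a) = \<kappa> * of_real N" using N by (simp add: \<kappa>_def)
    ultimately have "cnj \<kappa> * of_real N = \<kappa> * of_real N"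
      by (metis complex_cnj_cnj complex_cnj_complex_of_real complex_cnj_mult)
    then show ?thesis using N by simp
  qed
  then obtain k where k: "\<kappa> = of_real k" by (metis Reals_cases Reals_cnj_iff)
  have quad: "L2_inner (R f) f = of_real (k * (cmod (L2_inner f a))\<^sup>2)" if f: "f \<in> L2" for f
  proof -
    have "L2_inner (R f) f = \<kappa> * (L2_inner f a * cnj (L2_inner f a))"
      using inner[OF f f] I_eq[OF f] by (simp add: cnj_L2_inner)
    then show ?thesis by (simp only: k complex_norm_square[symmetric] of_real_mult)
  qed
  have kpos: "k > 0"
  proof (rule ccontr)
    assume "\<not> k > 0"
    define B where "B = (SOME B. is_onb (B :: ('a \<Rightarrow> complex) set))"
    have "\<exists>B. is_onb (B :: ('a \<Rightarrow> complex) set)" using tc by (auto simp: trace_class_def)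
    then have "is_onb B" unfolding B_def by (rule someI_ex)
    then have BL: "B \<subseteq> L2" by (simp add: is_onb_def)
    let ?g = "\<lambda>e. k * (cmod (L2_inner e a))\<^sup>2"
    have "(\<Sum>\<^sub>\<infinity>e\<in>B. complex_of_real (?g e)) = (\<Sum>\<^sub>\<infinity>e\<in>B. L2_inner (R e) e)"
      by (rule infsum_cong) (use BL quad in auto)
    also have "\<dots> = 1" using tr by (simp add: op_trace_def B_def)
    finally have one: "(\<Sum>\<^sub>\<infinity>e\<in>B. complex_of_real (?g e)) = 1" .
    \<comment> \<open>A divergent sum has the value 0, hence this one converges.\<close>
    then have "(\<lambda>e. complex_of_real (?g e)) summable_on B"
      using infsum_not_exists by fastforce
    then have "((\<lambda>e. complex_of_real (?g e)) has_sum complex_of_real 1) B"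
      using has_sum_infsum one by fastforce
    then have "(?g has_sum 1) B" unfolding has_sum_of_real_iff .
    then have "infsum (\<lambda>e. - ?g e) B = - 1" by (simp add: infsumI has_sum_uminus)
    moreover have "infsum (\<lambda>e. - ?g e) B \<ge> 0"
      by (rule infsum_nonneg) (use \<open>\<not> k > 0\<close> in \<open>auto simp: mult_nonpos_nonneg\<close>)
    ultimately show False by simp
  qed
  have "positive_operator R"
    unfolding positive_operator_def
  proof (intro conjI ballI bd)
    fix f :: "'a \<Rightarrow> complex" assume "f \<in> L2"
    then show "L2_inner (R f) f \<in> \<real>\<^sub>\<ge>\<^sub>0"
      unfolding quad[OF \<open>f \<in> L2\<close>] nonneg_Reals_of_real_iff using kpos by simp
  qed
  then show ?thesis using rank tc sa tr by (simp add: density_operator_def)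
qed

end

section \<open>Rank-one density operators\<close>

theorem lemma1:
  fixes hbar :: real
    and R :: "(real^'n) operator"
    and r :: "(real^'n) \<times> (real^'n) \<Rightarrow> complex"
    and F :: "(real^'n) \<times> (real^'n) \<Rightarrow> complex"
  assumes "hbar > 0"
    and "trace_class R" and "self_adjoint R" and "op_trace R = 1"
    and "integral_kernel R r"
    and "is_partial_fourier (wigner hbar r) F"
    and "Ck 1 F" and "\<forall>p. F p \<noteq> 0"
  shows "(rank_one R \<and> density_operator R) \<longleftrightarrow>
    (\<forall>j k.
      distr_eq
        (\<lambda>\<phi>. complex_of_real (4 / hbar\<^sup>2) *
              distr_deriv (dy j) (distr_of (\<lambda>p. dir_deriv (dy k) F p / F p)) \<phi>)
        (distr_deriv (dx j) (distr_of (\<lambda>p. dir_deriv (dx k) F p / F p))) \<and>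
      distr_eq
        (distr_deriv (dy j) (distr_of (\<lambda>p. dir_deriv (dx k) F p / F p)))
        (distr_deriv (dx j) (distr_of (\<lambda>p. dir_deriv (dy k) F p / F p))))"
proof -
  have nz: "\<And>p. F p \<noteq> 0" using assms(8) by blast
  have Fc: "continuous_on UNIV F" by (rule Ck_imp_continuous[OF assms(7)])
  define K where "K p = F (kernel_coord hbar p)" for p
  interpret continuous_kernel R r K
  proof
    show "integral_kernel R r" by fact
    then have "r \<in> L2" by (simp add: integral_kernel_def)
    then show "AE p in lborel. r p = K p"
      unfolding K_def by (rule kernel_AE_eq[OF assms(1) _ assms(6) nz Fc])
    show "continuous_on UNIV K"
      unfolding K_def[abs_def] by (rule continuous_on_compose2[OF Fc kernel_coord_continuous]) simp
    show "\<And>p. K p \<noteq> 0" by (simp add: K_def nz)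
  qed
  have "(rank_one R \<and> density_operator R) \<longleftrightarrow>
      (\<forall>X X' Y Y'. K (X, Y) * K (X', Y') = K (X, Y') * K (X', Y))"
    using rank_one_imp_factorizes factorizes_imp_rank_one[OF _ assms(2-4)] by blast
  also have "\<dots> \<longleftrightarrow> (\<forall>a b. splits_along F (kernel_coord hbar (a, 0)) (kernel_coord hbar (0, b)))"
    unfolding K_def using assms(1) by (subst splits_along_kernel_iff) simp_all
  finally show ?thesis
    unfolding log_hess_equations_iff[OF assms(1) assms(7) nz] .
qed

end
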